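(* Let $E(1)$ be the connected non-abelian 2-dimensional Lie group, $\mathfrak g_2$ its Lie algebra, and let $g_1,g_2$ be two left invariant Riemannian metrics on $E(1)$. Then the following holds: (i) A Riemannian immersion (and homomorphism) $i:\mathbb R\to(E(1),g_1)$ is minimal if and only if $d_0i(\mathbb R)$ is orthogonal to $[\mathfrak g_2,\mathfrak g_2]$. (ii) Any homomorphism $\chi:(E(1),g_1)\to\mathbb R$ is biharmonic, and never harmonic unless it is constant. (iii) If $\phi:(E(1),g_1)\to(E(1),g_2)$ is a non constant homomorphism which is harmonic, then there exists a constant $\lambda>0$ such that $\phi^*g_2=\lambda g_1$. (iv) If $\phi:(E(1),g_1)\to(E(1),g_2)$ is a homomorphism which is biharmonic and not harmonic, then there exist a Riemannian immersion (and homomorphism) $i:\mathbb R\to(E(1),g_2)$ and a biharmonic homomorphism $\chi:(E(1),g_1)\to\mathbb R$ such that $\phi=i\circ\chi$.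
   Context: All maps between Lie groups are Lie group homomorphisms. $\mathbb R$ carries its standard (additive) group structure and Euclidean metric. A Riemannian immersion is an isometric immersion; it is minimal if its mean curvature vanishes, equivalently if it is harmonic. For a smooth map $\phi:(M,g)\to(N,h)$ of Riemannian manifolds and a local orthonormal frame $(E_i)$ of $TM$, the tension field is $\tau(\phi)=\sum_i(\nabla_{E_i}d\phi)(E_i)$, and the bitension field is $\tau_2(\phi)=-\sum_i\big((\nabla^\phi)^2_{E_i,E_i}\tau(\phi)+R^N(\tau(\phi),d\phi(E_i))d\phi(E_i)\big)$, where $\nabla^\phi$ is the pull-back of the Levi-Civita connection of $N$, $(\nabla^\phi)^2_{X,Y}=\nabla^\phi_X\nabla^\phi_Y-\nabla^\phi_{\nabla^M_XY}$ and $R^N(X,Y)=\nabla_X\nabla_Y-\nabla_Y\nabla_X-\nabla_{[X,Y]}$. The map $\phi$ is harmonic if $\tau(\phi)=0$ and biharmonic if $\tau_2(\phi)=0$. *)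

theory Defs
  imports "HOL-Analysis.Analysis" "HOL-Algebra.Group"
begin

text \<open>
  All manifolds here are open subsets of Euclidean spaces (a single global chart), so every tangent
  space is the ambient vector space, a vector field on \<open>M\<close> is a function \<open>'a \<Rightarrow> 'a\<close>, and a
  Riemannian metric is a function \<open>g\<close> with \<open>g x u v\<close> the product of \<open>u, v\<close> at \<open>x\<close>. Only the values
  of functions, fields and metrics on the open set are relevant.
\<close>

section \<open>Smooth maps\<close>

abbreviation differential :: "('a::real_normed_vector \<Rightarrow> 'b::real_normed_vector) \<Rightarrow> 'a \<Rightarrow> 'a \<Rightarrow> 'b"
  where "differential f x \<equiv> frechet_derivative f (at x)"

text \<open>\<open>C\<^sup>k\<close> maps, through iterated directional derivatives. For an open subset of a Euclidean space
  this is the usual notion.\<close>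

primrec Ck_on :: "nat \<Rightarrow> 'a::euclidean_space set \<Rightarrow> ('a \<Rightarrow> 'b::real_normed_vector) \<Rightarrow> bool" where
  "Ck_on 0 S f \<longleftrightarrow> continuous_on S f"
| "Ck_on (Suc k) S f \<longleftrightarrow>
     (\<forall>x\<in>S. f differentiable (at x)) \<and> (\<forall>v. Ck_on k S (\<lambda>x. differential f x v))"

definition smooth_on :: "'a::euclidean_space set \<Rightarrow> ('a \<Rightarrow> 'b::real_normed_vector) \<Rightarrow> bool" where
  "smooth_on S f \<longleftrightarrow> (\<forall>k. Ck_on k S f)"

section \<open>Riemannian metrics and the Levi-Civita connection\<close>

type_synonym 'a metric = "'a \<Rightarrow> 'a \<Rightarrow> 'a \<Rightarrow> real"

definition riemannian_metric :: "'a::euclidean_space set \<Rightarrow> 'a metric \<Rightarrow> bool" where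
  "riemannian_metric M g \<longleftrightarrow>
     (\<forall>u v. smooth_on M (\<lambda>x. g x u v)) \<and>
     (\<forall>x\<in>M. bilinear (g x) \<and> (\<forall>u v. g x u v = g x v u) \<and> (\<forall>v. v \<noteq> 0 \<longrightarrow> g x v v > 0))"

definition flat_metric :: "'a::euclidean_space metric" where
  "flat_metric x u v = inner u v"

text \<open>The connection coefficients at \<open>x\<close>: \<open>\<Gamma> u v\<close> is the covariant derivative along \<open>u\<close> of the
  constant field \<open>v\<close>. Symmetry of \<open>\<Gamma>\<close> says that the connection is torsion free, the last clause that
  it is metric (for constant fields, hence for all fields by the Leibniz rule). By the Koszul
  formula there is exactly one such \<open>\<Gamma>\<close>.\<close>

definition christoffel :: "'a::euclidean_space metric \<Rightarrow> 'a \<Rightarrow> 'a \<Rightarrow> 'a \<Rightarrow> 'a" where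
  "christoffel g x = (THE \<Gamma>. bilinear \<Gamma> \<and> (\<forall>u v. \<Gamma> u v = \<Gamma> v u) \<and>
     (\<forall>u v w. differential (\<lambda>y. g y v w) x u = g x (\<Gamma> u v) w + g x v (\<Gamma> u w)))"

definition nabla :: "'a::euclidean_space metric \<Rightarrow> ('a \<Rightarrow> 'a) \<Rightarrow> ('a \<Rightarrow> 'a) \<Rightarrow> 'a \<Rightarrow> 'a" where
  "nabla g X Y x = differential Y x (X x) + christoffel g x (X x) (Y x)"

definition lie_bracket :: "('a::euclidean_space \<Rightarrow> 'a) \<Rightarrow> ('a \<Rightarrow> 'a) \<Rightarrow> 'a \<Rightarrow> 'a" where
  "lie_bracket X Y x = differential Y x (X x) - differential X x (Y x)"

definition curvature_field ::
    "'a::euclidean_space metric \<Rightarrow> ('a \<Rightarrow> 'a) \<Rightarrow> ('a \<Rightarrow> 'a) \<Rightarrow> ('a \<Rightarrow> 'a) \<Rightarrow> 'a \<Rightarrow> 'a" where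
  "curvature_field g X Y Z x =
     nabla g X (nabla g Y Z) x - nabla g Y (nabla g X Z) x - nabla g (lie_bracket X Y) Z x"

text \<open>The curvature is tensorial, so its value on tangent vectors at a point may be computed with
  any extensions to fields; we take the constant ones.\<close>

definition curvature :: "'a::euclidean_space metric \<Rightarrow> 'a \<Rightarrow> 'a \<Rightarrow> 'a \<Rightarrow> 'a \<Rightarrow> 'a" where
  "curvature g p u v w = curvature_field g (\<lambda>_. u) (\<lambda>_. v) (\<lambda>_. w) p"

definition orthonormal_frame ::
    "'a::euclidean_space set \<Rightarrow> 'a metric \<Rightarrow> ('a \<Rightarrow> 'a \<Rightarrow> 'a) \<Rightarrow> bool" where
  "orthonormal_frame M g E \<longleftrightarrow>
     (\<forall>b\<in>Basis. smooth_on M (E b)) \<and>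
     (\<forall>x\<in>M. \<forall>b\<in>Basis. \<forall>c\<in>Basis. g x (E b x) (E c x) = (if b = c then 1 else 0))"

section \<open>Harmonic and biharmonic maps\<close>

text \<open>In this section \<open>\<phi>\<close> is a map from \<open>(M, g)\<close> to \<open>(N, h)\<close> and \<open>V :: 'a \<Rightarrow> 'b\<close> a vector field
  along \<open>\<phi>\<close>.\<close>

definition pullback_metric ::
    "'b::euclidean_space metric \<Rightarrow> ('a::euclidean_space \<Rightarrow> 'b) \<Rightarrow> 'a metric" where
  "pullback_metric h \<phi> x u v = h (\<phi> x) (differential \<phi> x u) (differential \<phi> x v)"

definition pullback_nabla ::
    "'b::euclidean_space metric \<Rightarrow> ('a::euclidean_space \<Rightarrow> 'b) \<Rightarrow> ('a \<Rightarrow> 'a) \<Rightarrow> ('a \<Rightarrow> 'b) \<Rightarrow> 'a \<Rightarrow> 'b"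
  where
  "pullback_nabla h \<phi> X V x =
     differential V x (X x) + christoffel h (\<phi> x) (differential \<phi> x (X x)) (V x)"

text \<open>\<open>(\<nabla>\<^sub>X d\<phi>) Y\<close>\<close>

definition nabla_differential ::
    "'a::euclidean_space metric \<Rightarrow> 'b::euclidean_space metric \<Rightarrow> ('a \<Rightarrow> 'b) \<Rightarrow>
       ('a \<Rightarrow> 'a) \<Rightarrow> ('a \<Rightarrow> 'a) \<Rightarrow> 'a \<Rightarrow> 'b" where
  "nabla_differential g h \<phi> X Y x =
     pullback_nabla h \<phi> X (\<lambda>y. differential \<phi> y (Y y)) x - differential \<phi> x (nabla g X Y x)"

definition tension ::
    "'a::euclidean_space metric \<Rightarrow> 'b::euclidean_space metric \<Rightarrow> ('a \<Rightarrow> 'b) \<Rightarrow>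
       ('a \<Rightarrow> 'a \<Rightarrow> 'a) \<Rightarrow> 'a \<Rightarrow> 'b" where
  "tension g h \<phi> E x = (\<Sum>b\<in>Basis. nabla_differential g h \<phi> (E b) (E b) x)"

definition pullback_nabla2 ::
    "'a::euclidean_space metric \<Rightarrow> 'b::euclidean_space metric \<Rightarrow> ('a \<Rightarrow> 'b) \<Rightarrow>
       ('a \<Rightarrow> 'a) \<Rightarrow> ('a \<Rightarrow> 'a) \<Rightarrow> ('a \<Rightarrow> 'b) \<Rightarrow> 'a \<Rightarrow> 'b" where
  "pullback_nabla2 g h \<phi> X Y V x =
     pullback_nabla h \<phi> X (pullback_nabla h \<phi> Y V) x - pullback_nabla h \<phi> (nabla g X Y) V x"

definition bitension ::
    "'a::euclidean_space metric \<Rightarrow> 'b::euclidean_space metric \<Rightarrow> ('a \<Rightarrow> 'b) \<Rightarrow>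
       ('a \<Rightarrow> 'a \<Rightarrow> 'a) \<Rightarrow> 'a \<Rightarrow> 'b" where
  "bitension g h \<phi> E x =
     - (\<Sum>b\<in>Basis. pullback_nabla2 g h \<phi> (E b) (E b) (tension g h \<phi> E) x
          + curvature h (\<phi> x) (tension g h \<phi> E x)
              (differential \<phi> x (E b x)) (differential \<phi> x (E b x)))"

text \<open>Tension and bitension field do not depend on the orthonormal frame, and a Riemannian metric
  on an open set of a Euclidean space has a smooth global orthonormal frame (Gram-Schmidt), so the
  quantification over frames only says that any frame may be used.\<close>

definition harmonic ::
    "'a::euclidean_space set \<Rightarrow> 'a metric \<Rightarrow> 'b::euclidean_space metric \<Rightarrow> ('a \<Rightarrow> 'b) \<Rightarrow> bool" where
  "harmonic M g h \<phi> \<longleftrightarrow> (\<forall>E. orthonormal_frame M g E \<longrightarrow> (\<forall>x\<in>M. tension g h \<phi> E x = 0))"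

definition biharmonic ::
    "'a::euclidean_space set \<Rightarrow> 'a metric \<Rightarrow> 'b::euclidean_space metric \<Rightarrow> ('a \<Rightarrow> 'b) \<Rightarrow> bool" where
  "biharmonic M g h \<phi> \<longleftrightarrow> (\<forall>E. orthonormal_frame M g E \<longrightarrow> (\<forall>x\<in>M. bitension g h \<phi> E x = 0))"

section \<open>Riemannian immersions and minimality\<close>

definition riemannian_immersion ::
    "'a::euclidean_space set \<Rightarrow> 'a metric \<Rightarrow> 'b::euclidean_space metric \<Rightarrow> ('a \<Rightarrow> 'b) \<Rightarrow> bool" where
  "riemannian_immersion M g h \<phi> \<longleftrightarrow> smooth_on M \<phi> \<and>
     (\<forall>x\<in>M. inj (differential \<phi> x) \<and> (\<forall>u v. pullback_metric h \<phi> x u v = g x u v))"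

text \<open>The component of \<open>v\<close> orthogonal to the image of the differential of \<open>\<phi>\<close> at \<open>x\<close>.\<close>

definition normal_part ::
    "'b::euclidean_space metric \<Rightarrow> ('a::euclidean_space \<Rightarrow> 'b) \<Rightarrow> 'a \<Rightarrow> 'b \<Rightarrow> 'b" where
  "normal_part h \<phi> x v = (THE w. (\<exists>u. v = differential \<phi> x u + w) \<and>
     (\<forall>u. h (\<phi> x) (differential \<phi> x u) w = 0))"

definition second_fundamental_form ::
    "'b::euclidean_space metric \<Rightarrow> ('a::euclidean_space \<Rightarrow> 'b) \<Rightarrow> ('a \<Rightarrow> 'a) \<Rightarrow> ('a \<Rightarrow> 'a) \<Rightarrow> 'a \<Rightarrow> 'b"
  where
  "second_fundamental_form h \<phi> X Y x =
     normal_part h \<phi> x (pullback_nabla h \<phi> X (\<lambda>y. differential \<phi> y (Y y)) x)"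

definition mean_curvature ::
    "'b::euclidean_space metric \<Rightarrow> ('a::euclidean_space \<Rightarrow> 'b) \<Rightarrow> ('a \<Rightarrow> 'a \<Rightarrow> 'a) \<Rightarrow> 'a \<Rightarrow> 'b" where
  "mean_curvature h \<phi> E x =
     (1 / real DIM('a)) *\<^sub>R (\<Sum>b\<in>Basis. second_fundamental_form h \<phi> (E b) (E b) x)"

definition minimal ::
    "'a::euclidean_space set \<Rightarrow> 'a metric \<Rightarrow> 'b::euclidean_space metric \<Rightarrow> ('a \<Rightarrow> 'b) \<Rightarrow> bool" where
  "minimal M g h \<phi> \<longleftrightarrow> (\<forall>E. orthonormal_frame M g E \<longrightarrow> (\<forall>x\<in>M. mean_curvature h \<phi> E x = 0))"

section \<open>Lie groups\<close>

definition lie_group :: "('a::euclidean_space) monoid \<Rightarrow> bool" where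
  "lie_group G \<longleftrightarrow> group G \<and> open (carrier G) \<and>
     smooth_on (carrier G \<times> carrier G) (\<lambda>p. fst p \<otimes>\<^bsub>G\<^esub> snd p) \<and>
     smooth_on (carrier G) (\<lambda>x. inv\<^bsub>G\<^esub> x)"

definition lie_hom ::
    "('a::euclidean_space) monoid \<Rightarrow> ('b::euclidean_space) monoid \<Rightarrow> ('a \<Rightarrow> 'b) set" where
  "lie_hom G H = {\<phi> \<in> hom G H. smooth_on (carrier G) \<phi>}"

definition left_invariant_metric :: "('a::euclidean_space) monoid \<Rightarrow> 'a metric \<Rightarrow> bool" where
  "left_invariant_metric G g \<longleftrightarrow> riemannian_metric (carrier G) g \<and>
     (\<forall>a\<in>carrier G. \<forall>x\<in>carrier G. \<forall>u v. pullback_metric g (\<lambda>y. a \<otimes>\<^bsub>G\<^esub> y) x u v = g x u v)"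

definition left_invariant_field :: "('a::euclidean_space) monoid \<Rightarrow> 'a \<Rightarrow> 'a \<Rightarrow> 'a" where
  "left_invariant_field G u x = differential (\<lambda>y. x \<otimes>\<^bsub>G\<^esub> y) \<one>\<^bsub>G\<^esub> u"

text \<open>The Lie algebra of \<open>G\<close> is the tangent space at the identity, i.e. the whole ambient space,
  with this bracket.\<close>

definition lie_algebra_bracket :: "('a::euclidean_space) monoid \<Rightarrow> 'a \<Rightarrow> 'a \<Rightarrow> 'a" where
  "lie_algebra_bracket G u v =
     lie_bracket (left_invariant_field G u) (left_invariant_field G v) \<one>\<^bsub>G\<^esub>"

definition derived_algebra :: "('a::euclidean_space) monoid \<Rightarrow> 'a set" where
  "derived_algebra G = span {lie_algebra_bracket G u v | u v. True}"

definition real_line :: "real monoid" where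
  "real_line = \<lparr>carrier = UNIV, mult = (+), one = 0\<rparr>"

text \<open>The connected non-abelian Lie group of dimension 2, unique up to isomorphism, realised as the
  group of maps \<open>t \<mapsto> a t + b\<close> with \<open>a > 0\<close> under composition; such a map is the pair \<open>(a, b)\<close>.\<close>

definition E1 :: "(real \<times> real) monoid" where
  "E1 = \<lparr>carrier = {p. fst p > 0},
         mult = (\<lambda>p q. (fst p * fst q, fst p * snd q + snd p)), one = (1, 0)\<rparr>"

subsection \<open>\<open>E1\<close> is a connected non-abelian Lie group\<close>

lemma Ck_on_cong:
  assumes "open S" "\<And>x. x \<in> S \<Longrightarrow> f x = g x" "Ck_on k S f"
  shows "Ck_on k S g"
  using assms(2,3)
proof (induction k arbitrary: f g)
  case 0
  then show ?case by (metis Ck_on.simps(1) continuous_on_cong)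
next
  case (Suc k)
  have 1: "(g has_derivative differential f x) (at x)" if "x \<in> S" for x
  proof -
    have "(f has_derivative differential f x) (at x)"
      using Suc.prems(2) that by (simp add: frechet_derivative_works)
    then show ?thesis
      using has_derivative_transform_within_open[OF _ assms(1) that] Suc.prems(1) by blast
  qed
  then have "differential g x = differential f x" if "x \<in> S" for x
    using that by (metis frechet_derivative_at)
  then have "Ck_on k S (\<lambda>x. differential g x v)" for v
    using Suc.IH[of "\<lambda>x. differential f x v" "\<lambda>x. differential g x v"] Suc.prems(2) by simp
  then show ?case using 1 by (auto simp: differentiable_def)
qed

lemma Ck_on_SucI:
  assumes "open S" "\<And>x. x \<in> S \<Longrightarrow> (f has_derivative f' x) (at x)" "\<And>v. Ck_on k S (\<lambda>x. f' x v)"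
  shows "Ck_on (Suc k) S f"
proof -
  have "Ck_on k S (\<lambda>x. differential f x v)" for v
    by (rule Ck_on_cong[OF assms(1) _ assms(3)[of v]]) (metis assms(2) frechet_derivative_at)
  then show ?thesis using assms(2) by (auto simp: differentiable_def)
qed

lemma Ck_on_Suc_derivative:
  assumes "Ck_on (Suc k) S f" "x \<in> S"
  shows "(f has_derivative differential f x) (at x)"
  using assms by (simp add: frechet_derivative_works)

lemma Ck_on_Suc_imp: "Ck_on (Suc k) S f \<Longrightarrow> Ck_on k S f"
proof (induction k arbitrary: f)
  case 0
  then show ?case
    by (auto intro!: continuous_at_imp_continuous_on differentiable_imp_continuous_within)
next
  case (Suc k)
  then show ?case by (metis Ck_on.simps(2))
qed

lemma Ck_on_const: "open S \<Longrightarrow> Ck_on k S (\<lambda>_. c)"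
proof (induction k arbitrary: c)
  case (Suc k)
  then show ?case by (intro Ck_on_SucI[where f' = "\<lambda>_ _. 0"]) auto
qed auto

lemma Ck_on_bounded_linear:
  assumes "open S" "bounded_linear f"
  shows "Ck_on k S f"
proof (cases k)
  case 0
  then show ?thesis using assms(2) by (simp add: linear_continuous_on)
next
  case (Suc m)
  then show ?thesis
    unfolding Suc using assms
    by (intro Ck_on_SucI[where f' = "\<lambda>_. f"] Ck_on_const bounded_linear_imp_has_derivative)
qed

lemma Ck_on_add:
  assumes "open S"
  shows "Ck_on k S f \<Longrightarrow> Ck_on k S g \<Longrightarrow> Ck_on k S (\<lambda>x. f x + g x)"
proof (induction k arbitrary: f g)
  case (Suc k)
  show ?case
  proof (rule Ck_on_SucI[where f' = "\<lambda>x v. differential f x v + differential g x v", OF assms])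
    fix x assume "x \<in> S"
    then show "((\<lambda>x. f x + g x) has_derivative
        (\<lambda>v. differential f x v + differential g x v)) (at x)"
      using Suc.prems by (intro has_derivative_add Ck_on_Suc_derivative)
  qed (use Suc in auto)
qed (auto intro: continuous_intros)

lemma Ck_on_bilinear:
  assumes "open S" "bounded_bilinear B"
  shows "Ck_on k S f \<Longrightarrow> Ck_on k S g \<Longrightarrow> Ck_on k S (\<lambda>x. B (f x) (g x))"
proof (induction k arbitrary: f g)
  case 0
  then show ?case by (auto intro: bounded_bilinear.continuous_on[OF assms(2)])
next
  case (Suc k)
  show ?case
  proof (intro Ck_on_SucI[where
        f' = "\<lambda>x v. B (f x) (differential g x v) + B (differential f x v) (g x)"] assms(1)
        Ck_on_add)
    fix x assume "x \<in> S"
    then show "((\<lambda>x. B (f x) (g x)) has_derivative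
        (\<lambda>v. B (f x) (differential g x v) + B (differential f x v) (g x))) (at x)"
      using Suc.prems by (intro bounded_bilinear.FDERIV[OF assms(2)] Ck_on_Suc_derivative) auto
  next
    fix v
    have "Ck_on k S f" "Ck_on k S g" using Suc.prems Ck_on_Suc_imp by blast+
    then show "Ck_on k S (\<lambda>x. B (f x) (differential g x v))"
      "Ck_on k S (\<lambda>x. B (differential f x v) (g x))"
      using Suc by auto
  qed
qed

lemmas Ck_on_mult = Ck_on_bilinear[OF _ bounded_bilinear_mult]

lemma Ck_on_inverse:
  fixes f :: "'a::euclidean_space \<Rightarrow> real"
  assumes "open S" "\<And>x. x \<in> S \<Longrightarrow> f x \<noteq> 0"
  shows "Ck_on k S f \<Longrightarrow> Ck_on k S (\<lambda>x. inverse (f x))"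
proof (induction k)
  case 0
  then show ?case using assms by (auto intro: continuous_intros)
next
  case (Suc k)
  then have ih: "Ck_on k S (\<lambda>x. inverse (f x))" using Ck_on_Suc_imp by blast
  show ?case
  proof (intro Ck_on_SucI[where
        f' = "\<lambda>x v. (-1) * (inverse (f x) * differential f x v * inverse (f x))"] assms(1))
    fix x assume "x \<in> S"
    then show "((\<lambda>x. inverse (f x)) has_derivative
        (\<lambda>v. (-1) * (inverse (f x) * differential f x v * inverse (f x)))) (at x)"
      using Deriv.has_derivative_inverse[OF assms(2) Ck_on_Suc_derivative[OF Suc.prems]] by simp
  next
    fix v
    show "Ck_on k S (\<lambda>x. (-1) * (inverse (f x) * differential f x v * inverse (f x)))"
      using Suc.prems ih assms(1) by (intro Ck_on_mult Ck_on_const) auto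
  qed
qed

lemma Ck_on_linear_comp:
  assumes "open S" "bounded_linear L"
  shows "Ck_on k S f \<Longrightarrow> Ck_on k S (\<lambda>x. L (f x))"
proof (induction k arbitrary: f)
  case 0
  then show ?case by (auto intro: bounded_linear.continuous_on[OF assms(2)])
next
  case (Suc k)
  show ?case
  proof (rule Ck_on_SucI[where f' = "\<lambda>x v. L (differential f x v)", OF assms(1)])
    fix x assume "x \<in> S"
    then show "((\<lambda>x. L (f x)) has_derivative (\<lambda>v. L (differential f x v))) (at x)"
      using Suc.prems by (intro bounded_linear.has_derivative[OF assms(2)] Ck_on_Suc_derivative)
  qed (use Suc in auto)
qed

lemma Ck_on_Pair:
  fixes f :: "'a::euclidean_space \<Rightarrow> real" and g :: "'a \<Rightarrow> real"
  assumes "open S" "Ck_on k S f" "Ck_on k S g"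
  shows "Ck_on k S (\<lambda>x. (f x, g x))"
proof -
  have l: "bounded_linear (\<lambda>t::real. (t, 0::real))" "bounded_linear (\<lambda>t::real. (0::real, t))"
    by (auto intro!: bounded_linear_Pair bounded_linear_ident bounded_linear_zero)
  show ?thesis
    using Ck_on_add[OF assms(1) Ck_on_linear_comp[OF assms(1) l(1) assms(2)]
        Ck_on_linear_comp[OF assms(1) l(2) assms(3)]] by simp
qed

lemma E1_group: "group E1"
proof (rule groupI)
  fix x assume "x \<in> carrier E1"
  then show "\<exists>y\<in>carrier E1. y \<otimes>\<^bsub>E1\<^esub> x = \<one>\<^bsub>E1\<^esub>"
    by (intro bexI[where x = "(inverse (fst x), - (inverse (fst x) * snd x))"]) (auto simp: E1_def)
qed (auto simp: E1_def algebra_simps)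

lemma E1_inv:
  assumes "x \<in> carrier E1"
  shows "inv\<^bsub>E1\<^esub> x = (inverse (fst x), - 1 * (inverse (fst x) * snd x))"
  by (rule group.inv_equality[OF E1_group]) (use assms in \<open>auto simp: E1_def\<close>)

lemma E1_open: "open (carrier E1)"
  by (auto simp: E1_def intro!: open_Collect_less continuous_intros)

lemma E1_lie_group: "lie_group E1"
proof -
  let ?C = "carrier E1"
  have o: "open (?C \<times> ?C)" by (intro open_Times E1_open)
  have "Ck_on k (?C \<times> ?C) (\<lambda>p. fst p \<otimes>\<^bsub>E1\<^esub> snd p)" for k
    unfolding E1_def monoid.simps using o[unfolded E1_def monoid.simps]
    by (intro Ck_on_Pair Ck_on_add Ck_on_mult Ck_on_bounded_linear bounded_linear_fst
        bounded_linear_snd bounded_linear_fst_comp bounded_linear_snd_comp) auto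
  moreover have "Ck_on k ?C (\<lambda>x. (inverse (fst x), - 1 * (inverse (fst x) * snd x)))" for k
    using E1_open
    by (intro Ck_on_Pair Ck_on_mult Ck_on_inverse Ck_on_const Ck_on_bounded_linear
        bounded_linear_fst bounded_linear_snd) (auto simp: E1_def)
  then have "Ck_on k ?C (\<lambda>x. inv\<^bsub>E1\<^esub> x)" for k
    by (rule Ck_on_cong[OF E1_open E1_inv[symmetric], rotated])
  ultimately show ?thesis
    by (simp add: lie_group_def E1_group E1_open smooth_on_def)
qed

lemma E1_connected: "connected (carrier E1)"
proof -
  have "carrier E1 = {0<..} \<times> UNIV" by (auto simp: E1_def)
  then show ?thesis by (simp add: connected_Times)
qed

lemma E1_nonabelian: "\<not> comm_group E1"
proof
  assume "comm_group E1"
  then have "(2, 0) \<otimes>\<^bsub>E1\<^esub> (1, 1) = (1, 1) \<otimes>\<^bsub>E1\<^esub> (2, 0)"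
    by (intro comm_monoid.m_comm comm_group.axioms) (auto simp: E1_def)
  then show False by (simp add: E1_def)
qed

end

theory Submission
  imports Defs
begin

text \<open>
  A left invariant metric on \<open>E1\<close> is \<open>Q / (fst x)\<^sup>2\<close> for an inner product \<open>Q\<close> on the plane. With
  \<open>grad\<close> the vector such that \<open>Q grad u = fst u\<close>, the Levi-Civita connection on left invariant fields
  is \<open>A u v = Q u v *\<^sub>R grad - fst v *\<^sub>R u\<close>, so that for an orthonormal pair \<open>A e e + A f f = grad\<close>, and
  the curvature is constant, equal to \<open>- fst grad\<close>.

  The differential of a homomorphism \<open>\<phi>\<close> is the left translate of a linear map \<open>\<xi>\<close>, which either kills
  the derived algebra \<open>{0} \<times> \<real>\<close> or preserves the first coordinate. The tension and bitension
  fields are left translates of constant vectors. In the first case, with \<open>\<xi> u = fst u *\<^sub>R \<eta>\<close>, the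
  tension is a positive multiple of \<open>A \<eta> \<eta> - \<eta>\<close>, whose product with \<open>\<eta>\<close> is \<open>- Q \<eta> \<eta>\<close>; so \<open>\<phi>\<close>
  is not harmonic unless it is constant, and it factors through \<open>ln \<circ> fst\<close>. In the second case, let
  \<open>T\<close> be the trace of the pulled back form; the tension is \<open>w = T grad\<^sub>2 - 2 \<xi> grad\<^sub>1\<close>. If it vanishes, \<open>grad\<^sub>1\<close> is an eigenvector of the pulled
  back form for half of its trace, which forces conformality. The bitension is a multiple of \<open>w\<close>,
  and the Cauchy-Schwarz inequality shows that the factor vanishes only for degenerate \<open>\<xi>\<close>.
\<close>

section \<open>Calculus preliminaries and uniqueness of the connection coefficients\<close>

lemma differential_eqI: "(f has_derivative f') (at x) \<Longrightarrow> differential f x = f'"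
  by (metis frechet_derivative_at)

lemma differential_const [simp]: "differential (\<lambda>_. c) x = (\<lambda>_. 0)"
  by (intro differential_eqI has_derivative_const)

lemma smooth_on_has_derivative:
  assumes "smooth_on S f" "x \<in> S"
  shows "(f has_derivative differential f x) (at x)"
  using assms Ck_on_Suc_derivative unfolding smooth_on_def by blast

lemma sum_Basis_real_prod:
  fixes F :: "real \<times> real \<Rightarrow> 'c::comm_monoid_add"
  shows "(\<Sum>b\<in>Basis. F b) = F (1, 0) + F (0, 1)"
proof -
  have "(Basis :: (real \<times> real) set) = {(1, 0), (0, 1)}"
    by (auto simp: Basis_prod_def)
  then have "(\<Sum>b\<in>Basis. F b) = (\<Sum>b\<in>{(1, 0), (0, 1)}. F b)" by (rule arg_cong)
  then show ?thesis by (simp add: sum.insert_if)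
qed

lemma linear_real_prod_eq:
  fixes u :: "real \<times> real"
  assumes "linear f"
  shows "f u = fst u *\<^sub>R f (1, 0) + snd u *\<^sub>R f (0, 1)"
proof -
  have "f u = f (fst u *\<^sub>R (1, 0) + snd u *\<^sub>R (0, 1))" by (simp add: prod_eq_iff)
  then show ?thesis using assms by (simp add: linear_add linear_scale del: scaleR_Pair)
qed

text \<open>The Koszul argument: the difference of two candidates is symmetric in its arguments and
  skew with respect to the metric, hence zero.\<close>

lemma christoffel_eqI:
  assumes pos: "\<And>v. v \<noteq> 0 \<Longrightarrow> g x v v > 0"
    and bil: "bilinear (g x)" and sym: "\<And>u v. g x u v = g x v u"
    and \<Gamma>: "bilinear \<Gamma>" "\<And>u v. \<Gamma> u v = \<Gamma> v u"
      "\<And>u v w. differential (\<lambda>y. g y v w) x u = g x (\<Gamma> u v) w + g x v (\<Gamma> u w)"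
  shows "christoffel g x = \<Gamma>"
  unfolding christoffel_def
proof (rule the_equality)
  fix \<Gamma>'
  assume \<Gamma>': "bilinear \<Gamma>' \<and> (\<forall>u v. \<Gamma>' u v = \<Gamma>' v u) \<and>
    (\<forall>u v w. differential (\<lambda>y. g y v w) x u = g x (\<Gamma>' u v) w + g x v (\<Gamma>' u w))"
  define \<Delta> where "\<Delta> u v = \<Gamma>' u v - \<Gamma> u v" for u v
  have "g x (\<Delta> u v) w + g x v (\<Delta> u w) = 0" for u v w
    using \<Gamma>' \<Gamma>(3)[of v w u] by (simp add: \<Delta>_def bilinear_lsub[OF bil] bilinear_rsub[OF bil])
  moreover have "\<Delta> u v = \<Delta> v u" for u v
    using \<Gamma>(2)[of u v] \<Gamma>' by (simp add: \<Delta>_def)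
  ultimately have "g x (\<Delta> u v) w = 0" for u v w
    using sym by (smt (verit))
  then have "\<Delta> u v = 0" for u v using pos by (metis less_irrefl)
  then show "\<Gamma>' = \<Gamma>" by (simp add: \<Delta>_def fun_eq_iff)
qed (use \<Gamma> in auto)

lemma christoffel_flat_metric [simp]: "christoffel flat_metric x = (\<lambda>_ _. 0)"
  by (rule christoffel_eqI)
    (auto simp: flat_metric_def inner_commute bilinear_def linear_iff inner_left_distrib
      inner_right_distrib)

lemma curvature_flat_metric [simp]: "curvature flat_metric p u v w = 0"
  by (simp add: curvature_def curvature_field_def nabla_def[abs_def])

section \<open>Left translations and the Lie algebra of \<open>E1\<close>\<close>

lemma E1_simps [simp]:
  "x \<in> carrier E1 \<longleftrightarrow> fst x > 0"
  "x \<otimes>\<^bsub>E1\<^esub> y = (fst x * fst y, fst x * snd y + snd x)"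
  "\<one>\<^bsub>E1\<^esub> = (1, 0)"
  by (auto simp: E1_def)

lemma real_line_simps [simp]:
  "t \<in> carrier real_line" "s \<otimes>\<^bsub>real_line\<^esub> t = s + t" "\<one>\<^bsub>real_line\<^esub> = 0"
  by (auto simp: real_line_def)

lemma has_derivative_E1_left_translation:
  "((\<lambda>y. (a * fst y, a * snd y + b)) has_derivative (\<lambda>u. a *\<^sub>R u)) (at x)"
  by (auto intro!: derivative_eq_intros simp: scaleR_prod_def)

lemma left_invariant_field_E1: "left_invariant_field E1 u x = fst x *\<^sub>R u"
  unfolding left_invariant_field_def E1_simps
  by (simp add: differential_eqI[OF has_derivative_E1_left_translation])

text \<open>Every bracket is vertical, and bracketing with \<open>(1, 0)\<close> reproduces each
  vertical vector, so the brackets already form a subspace.\<close>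

lemma derived_algebra_E1: "derived_algebra E1 = range (Pair 0)"
proof -
  have 1: "differential (left_invariant_field E1 u) x = (\<lambda>v. fst v *\<^sub>R u)" for u x
    by (rule differential_eqI) (auto intro!: derivative_eq_intros
        simp: left_invariant_field_E1[abs_def])
  then have b: "lie_algebra_bracket E1 u v = (0, fst u * snd v - fst v * snd u)" for u v
    by (simp add: lie_algebra_bracket_def lie_bracket_def left_invariant_field_E1 prod_eq_iff)
  have "{lie_algebra_bracket E1 u v |u v. True} = range (Pair 0)"
  proof (intro equalityI subsetI)
    fix z :: "real \<times> real" assume "z \<in> range (Pair 0)"
    then have "z = lie_algebra_bracket E1 (1, 0) z" by (auto simp: b)
    then show "z \<in> {lie_algebra_bracket E1 u v |u v. True}" by blast
  qed (auto simp: b)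
  moreover have "subspace (range (Pair (0::real)) :: (real \<times> real) set)"
    by (auto simp: subspace_def zero_prod_def)
  ultimately show ?thesis
    unfolding derived_algebra_def by (metis span_eq_iff)
qed

section \<open>Left invariant metrics on \<open>E1\<close>\<close>

locale E1_metric =
  fixes g :: "(real \<times> real) metric"
  assumes left_invariant: "left_invariant_metric E1 g"
begin

definition Q :: "real \<times> real \<Rightarrow> real \<times> real \<Rightarrow> real" where
  "Q = g (1, 0)"

text \<open>The Gram determinant of \<open>Q\<close> in the standard basis, which is the denominator
  in Cramer's rule for \<open>grad\<close>.\<close>

definition disc :: real where
  "disc = Q (1, 0) (1, 0) * Q (0, 1) (0, 1) - (Q (1, 0) (0, 1))\<^sup>2"

definition grad :: "real \<times> real" where
  "grad = (Q (0, 1) (0, 1) / disc, - Q (1, 0) (0, 1) / disc)"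

text \<open>\<open>A u v\<close> is the covariant derivative, at the identity, of the left invariant field \<open>v\<close> along
  the left invariant field \<open>u\<close>.\<close>

definition A :: "real \<times> real \<Rightarrow> real \<times> real \<Rightarrow> real \<times> real" where
  "A u v = Q u v *\<^sub>R grad - fst v *\<^sub>R u"

lemma riem: "riemannian_metric (carrier E1) g"
  using left_invariant by (simp add: left_invariant_metric_def)

lemma bilinear_Q: "bilinear Q"
  using riem by (simp add: riemannian_metric_def Q_def del: split_paired_All)

lemmas Q_simps = bilinear_ladd[OF bilinear_Q] bilinear_radd[OF bilinear_Q]
  bilinear_lsub[OF bilinear_Q] bilinear_rsub[OF bilinear_Q]
  bilinear_lmul[OF bilinear_Q] bilinear_rmul[OF bilinear_Q]
  bilinear_lneg[OF bilinear_Q] bilinear_rneg[OF bilinear_Q]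
  bilinear_lzero[OF bilinear_Q] bilinear_rzero[OF bilinear_Q]

lemma Q_commute: "Q u v = Q v u"
  using riem by (simp add: riemannian_metric_def Q_def del: split_paired_All)

lemma Q_pos: "v \<noteq> 0 \<Longrightarrow> Q v v > 0"
  using riem by (simp add: riemannian_metric_def Q_def del: split_paired_All)

lemma Q_nonneg: "Q v v \<ge> 0"
  using Q_pos[of v] by (cases "v = 0") (auto simp: Q_simps)

lemma Q_zeroD: "Q v v = 0 \<Longrightarrow> v = 0"
  using Q_pos[of v] by force

text \<open>The differential of left translation by \<open>x\<close> is multiplication by
  \<open>fst x\<close>, so left invariance becomes a scaling law by bilinearity.\<close>

lemma metric_eq:
  assumes "fst x > 0"
  shows "g x u v = Q u v / (fst x)\<^sup>2"
proof -
  have "g (x \<otimes>\<^bsub>E1\<^esub> (1, 0)) (differential (\<lambda>y. x \<otimes>\<^bsub>E1\<^esub> y) (1, 0) u)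
      (differential (\<lambda>y. x \<otimes>\<^bsub>E1\<^esub> y) (1, 0) v) = Q u v" for u v
    using left_invariant assms
    unfolding left_invariant_metric_def pullback_metric_def Q_def
    by (metis E1_simps(1,3) E1_simps(2)[of _ "(1, 0)"] fst_conv mult.right_neutral mult_zero_right
        add_0 prod.collapse snd_conv zero_less_one)
  then have *: "g x (fst x *\<^sub>R u) (fst x *\<^sub>R v) = Q u v" for u v
    by (simp add: differential_eqI[OF has_derivative_E1_left_translation])
  have "bilinear (g x)" using riem assms by (simp add: riemannian_metric_def)
  then have "g x (fst x *\<^sub>R u) (fst x *\<^sub>R v) = (fst x)\<^sup>2 * g x u v"
    by (simp add: bilinear_lmul bilinear_rmul power2_eq_square)
  then show ?thesis using * assms by (simp add: field_simps)
qed

lemma Q_coords: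
  "Q u v = fst u * fst v * Q (1, 0) (1, 0) + (fst u * snd v + snd u * fst v) * Q (1, 0) (0, 1)
    + snd u * snd v * Q (0, 1) (0, 1)"
proof -
  have "Q u v = Q (fst u *\<^sub>R (1, 0) + snd u *\<^sub>R (0, 1)) (fst v *\<^sub>R (1, 0) + snd v *\<^sub>R (0, 1))"
    by (simp add: prod_eq_iff)
  then show ?thesis
    using Q_commute[of "(0, 1)" "(1, 0)"] by (simp add: Q_simps algebra_simps del: scaleR_Pair)
qed

lemma disc_pos: "disc > 0"
proof -
  let ?a = "Q (1, 0) (1, 0)" and ?b = "Q (1, 0) (0, 1)" and ?c = "Q (0, 1) (0, 1)"
  have "?a > 0" by (rule Q_pos) (simp add: zero_prod_def)
  \<comment> \<open>This vector is \<open>Q\<close>-orthogonal to \<open>(1, 0)\<close>, so its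
    square factors through the Gram determinant.\<close>
  then have "0 < Q (- ?b, ?a) (- ?b, ?a)" by (intro Q_pos) (simp add: zero_prod_def)
  also have "\<dots> = ?a * disc"
    unfolding Q_coords[of "(- ?b, ?a)"] disc_def by (simp add: algebra_simps power2_eq_square)
  finally show ?thesis using \<open>?a > 0\<close> by (simp add: zero_less_mult_iff)
qed

lemma Q_grad [simp]: "Q grad u = fst u" "Q u grad = fst u"
proof -
  show 1: "Q grad u = fst u"
  proof -
    have "Q grad u = fst u * ((Q (1, 0) (1, 0) * Q (0, 1) (0, 1) - (Q (1, 0) (0, 1))\<^sup>2) / disc)"
      unfolding Q_coords[of grad u] unfolding grad_def
      by (simp add: diff_divide_distrib algebra_simps power2_eq_square)
    then show ?thesis using disc_pos by (simp flip: disc_def)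
  qed
  then show "Q u grad = fst u" by (simp add: Q_commute)
qed

lemma fst_grad_pos: "fst grad > 0"
proof -
  have "grad \<noteq> 0" using Q_grad(1)[of "(1, 0)"] bilinear_lzero[OF bilinear_Q] by force
  then show ?thesis using Q_pos[of grad] by simp
qed

lemma A_simps:
  "A (u + u') v = A u v + A u' v" "A u (v + v') = A u v + A u v'"
  "A (u - u') v = A u v - A u' v" "A u (v - v') = A u v - A u v'"
  "A (c *\<^sub>R u) v = c *\<^sub>R A u v" "A u (c *\<^sub>R v) = c *\<^sub>R A u v"
  by (simp_all add: A_def Q_simps algebra_simps)

text \<open>In the left invariant frame the constant field \<open>v\<close> has coefficient
  \<open>v\<close> divided by \<open>fst\<close>. Differentiating that quotient accounts for the
  term beside \<open>A u v\<close>.\<close>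

lemma christoffel_eq:
  assumes "fst x > 0"
  shows "christoffel g x u v = (1 / fst x) *\<^sub>R (A u v - fst u *\<^sub>R v)"
proof -
  have "christoffel g x = (\<lambda>u v. (1 / fst x) *\<^sub>R (A u v - fst u *\<^sub>R v))"
  proof (rule christoffel_eqI)
    show "bilinear (\<lambda>u v. (1 / fst x) *\<^sub>R (A u v - fst u *\<^sub>R v))"
      by (auto simp: bilinear_def linear_iff A_simps algebra_simps add_divide_distrib)
    show "(1 / fst x) *\<^sub>R (A u v - fst u *\<^sub>R v) = (1 / fst x) *\<^sub>R (A v u - fst v *\<^sub>R u)" for u v
      by (simp add: A_def Q_commute[of u v])
    fix u v w
    have "((\<lambda>y. g y v w) has_derivative (\<lambda>u. - 2 * fst u * Q v w / fst x ^ 3)) (at x)"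
    proof (rule has_derivative_transform_within_open[OF _ E1_open])
      show "((\<lambda>y. Q v w / (fst y)\<^sup>2) has_derivative (\<lambda>u. - 2 * fst u * Q v w / fst x ^ 3)) (at x)"
        using assms by (auto intro!: derivative_eq_intros simp: field_simps power2_eq_square power3_eq_cube)
    qed (use assms metric_eq in auto)
    then show "differential (\<lambda>y. g y v w) x u =
        g x ((1 / fst x) *\<^sub>R (A u v - fst u *\<^sub>R v)) w + g x v ((1 / fst x) *\<^sub>R (A u w - fst u *\<^sub>R w))"
      using assms
      by (simp add: differential_eqI metric_eq A_def Q_simps Q_commute[of v u] field_simps
          power2_eq_square power3_eq_cube)
  qed (use riem assms in \<open>auto simp: riemannian_metric_def\<close>)
  then show ?thesis by simp
qed

text \<open>The form \<open>\<omega>\<close> is the pull-back of the Maurer-Cartan form of \<open>E1\<close> along \<open>\<phi>\<close>.\<close>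

lemma pullback_nabla_eq:
  fixes \<phi> :: "'a::euclidean_space \<Rightarrow> real \<times> real"
  assumes S: "open S" "x \<in> S" "\<And>y. y \<in> S \<Longrightarrow> V y = fst (\<phi> y) *\<^sub>R v y"
    and \<phi>: "(\<phi> has_derivative (\<lambda>u. fst (\<phi> x) *\<^sub>R \<omega> u)) (at x)" "fst (\<phi> x) > 0"
    and v: "(v has_derivative v') (at x)"
  shows "pullback_nabla g \<phi> X V x = fst (\<phi> x) *\<^sub>R (v' (X x) + A (\<omega> (X x)) (v x))"
proof -
  \<comment> \<open>The term from differentiating \<open>fst (\<phi> y)\<close> cancels the
    correction term in \<open>christoffel_eq\<close>, leaving only \<open>A\<close>.\<close>
  have "((\<lambda>y. fst (\<phi> y) *\<^sub>R v y) has_derivative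
      (\<lambda>u. fst (\<phi> x) *\<^sub>R v' u + (fst (\<phi> x) * fst (\<omega> u)) *\<^sub>R v x)) (at x)"
    using has_derivative_scaleR[OF has_derivative_fst[OF \<phi>(1)] v] by simp
  then have "(V has_derivative
      (\<lambda>u. fst (\<phi> x) *\<^sub>R v' u + (fst (\<phi> x) * fst (\<omega> u)) *\<^sub>R v x)) (at x)"
    by (rule has_derivative_transform_within_open[OF _ S(1,2)]) (simp add: S(3))
  then show ?thesis
    using \<phi>(2) S(2)
    by (simp add: pullback_nabla_def differential_eqI[OF \<phi>(1)] differential_eqI christoffel_eq A_simps
        S(3) algebra_simps)
qed

text \<open>The connection is its own pull-back along the identity map, whose form
  \<open>\<omega>\<close> divides by \<open>fst x\<close>.\<close>

lemma nabla_eq: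
  assumes "\<And>y. fst y > 0 \<Longrightarrow> Y y = fst y *\<^sub>R v y" "(v has_derivative v') (at x)" "fst x > 0"
  shows "nabla g X Y x = fst x *\<^sub>R (v' (X x) + A ((1 / fst x) *\<^sub>R X x) (v x))"
proof -
  have "nabla g X Y x = pullback_nabla g (\<lambda>y. y) X Y x"
    by (simp add: nabla_def pullback_nabla_def differential_eqI[OF has_derivative_ident])
  also have "\<dots> = fst x *\<^sub>R (v' (X x) + A ((1 / fst x) *\<^sub>R X x) (v x))"
    using assms by (intro pullback_nabla_eq[OF E1_open]) auto
  finally show ?thesis .
qed

text \<open>\<open>S\<close> is the connection on constant fields up to the factor
  \<open>1 / fst x\<close>. Such fields have zero bracket, so only the two second derivatives
  remain. The Gaussian curvature is \<open>- fst grad\<close>.\<close>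

lemma curvature_eq:
  assumes "fst p > 0"
  shows "curvature g p u v w = (- fst grad / (fst p)\<^sup>2) *\<^sub>R (Q v w *\<^sub>R u - Q u w *\<^sub>R v)"
proof -
  define S where "S u v = A u v - fst u *\<^sub>R v" for u v
  have 1: "nabla g (\<lambda>_. u) (nabla g (\<lambda>_. v) (\<lambda>_. w)) p =
      (1 / (fst p)\<^sup>2) *\<^sub>R (S u (S v w) - fst u *\<^sub>R S v w)" for u v w
  proof -
    have "(nabla g (\<lambda>_. v) (\<lambda>_. w) has_derivative (\<lambda>u. (- fst u / (fst p)\<^sup>2) *\<^sub>R S v w)) (at p)"
    proof (rule has_derivative_transform_within_open[OF _ E1_open])
      show "((\<lambda>y. (1 / fst y) *\<^sub>R S v w) has_derivative (\<lambda>u. (- fst u / (fst p)\<^sup>2) *\<^sub>R S v w)) (at p)"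
        using assms by (auto intro!: derivative_eq_intros simp: power2_eq_square)
    qed (use assms in \<open>auto simp: nabla_def christoffel_eq S_def\<close>)
    then show ?thesis
      unfolding nabla_def[of _ _ "nabla g (\<lambda>_. v) (\<lambda>_. w)"]
      using assms
      by (simp add: differential_eqI)
        (simp add: nabla_def christoffel_eq flip: S_def,
         simp add: S_def A_simps algebra_simps power2_eq_square)
  qed
  have "curvature g p u v w = (1 / (fst p)\<^sup>2) *\<^sub>R
      ((S u (S v w) - fst u *\<^sub>R S v w) - (S v (S u w) - fst v *\<^sub>R S u w))"
    using assms unfolding curvature_def curvature_field_def 1
    by (simp add: nabla_def lie_bracket_def christoffel_eq A_def Q_simps algebra_simps)
  also have "(S u (S v w) - fst u *\<^sub>R S v w) - (S v (S u w) - fst v *\<^sub>R S u w) =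
      (- fst grad) *\<^sub>R (Q v w *\<^sub>R u - Q u w *\<^sub>R v)"
    by (simp add: S_def A_def Q_simps Q_commute[of v u] prod_eq_iff algebra_simps)
  finally show ?thesis by simp
qed

end

section \<open>Orthonormal pairs at the identity and orthonormal frames\<close>

context E1_metric
begin

definition orthonormal_pair :: "real \<times> real \<Rightarrow> real \<times> real \<Rightarrow> bool" where
  "orthonormal_pair e f \<longleftrightarrow> Q e e = 1 \<and> Q f f = 1 \<and> Q e f = 0"

text \<open>The determinant \<open>d\<close> of the pair is nonzero, and Cramer's rule writes
  \<open>d *\<^sub>R x\<close> through \<open>e\<close> and \<open>f\<close>. A remainder
  \<open>x\<close> orthogonal to both is therefore orthogonal to itself.\<close>

lemma orthonormal_pair_expand:
  assumes "orthonormal_pair e f"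
  shows "u = Q u e *\<^sub>R e + Q u f *\<^sub>R f"
proof -
  note ef = assms[unfolded orthonormal_pair_def]
  define d where "d = fst e * snd f - snd e * fst f"
  have "d \<noteq> 0"
  proof
    assume "d = 0"
    then have 1: "fst f *\<^sub>R e - fst e *\<^sub>R f = 0" "snd f *\<^sub>R e - snd e *\<^sub>R f = 0"
      by (auto simp: d_def prod_eq_iff mult.commute)
    have "Q (fst f *\<^sub>R e - fst e *\<^sub>R f) e = 0" "Q (snd f *\<^sub>R e - snd e *\<^sub>R f) e = 0"
      unfolding 1 by (simp_all add: Q_simps)
    then have "f = 0" using ef by (simp add: Q_simps Q_commute[of f e] prod_eq_iff)
    then show False using ef by (simp add: Q_simps)
  qed
  define x where "x = u - (Q u e *\<^sub>R e + Q u f *\<^sub>R f)"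
  have 1: "Q x e = 0" "Q x f = 0"
    using ef by (simp_all add: x_def Q_simps Q_commute[of f e])
  have "d *\<^sub>R x = (fst x * snd f - snd x * fst f) *\<^sub>R e + (fst e * snd x - snd e * fst x) *\<^sub>R f"
    by (simp add: prod_eq_iff d_def algebra_simps)
  then have "Q x (d *\<^sub>R x) = 0" using 1 by (simp add: Q_simps)
  then have "x = 0" using \<open>d \<noteq> 0\<close> by (auto simp: Q_simps intro: Q_zeroD)
  then show ?thesis by (simp add: x_def)
qed

lemma orthonormal_pair_grad:
  "orthonormal_pair e f \<Longrightarrow> fst e *\<^sub>R e + fst f *\<^sub>R f = grad"
  using orthonormal_pair_expand[of e f grad] by simp

lemma orthonormal_pair_fst: "orthonormal_pair e f \<Longrightarrow> (fst e)\<^sup>2 + (fst f)\<^sup>2 = fst grad"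
  using arg_cong[OF orthonormal_pair_grad, of e f fst] by (simp add: power2_eq_square)

text \<open>By \<open>Q_grad\<close>, \<open>grad\<close> is orthogonal to \<open>(0, 1)\<close>;
  both only have to be normalised.\<close>

lemma orthonormal_pair_exists: "\<exists>e f. orthonormal_pair e f"
proof -
  have "Q (0, 1) (0, 1) > 0" by (rule Q_pos) (simp add: zero_prod_def)
  then have "orthonormal_pair ((1 / sqrt (fst grad)) *\<^sub>R grad) ((1 / sqrt (Q (0, 1) (0, 1))) *\<^sub>R (0, 1))"
    using fst_grad_pos by (simp add: orthonormal_pair_def Q_simps del: scaleR_Pair)
  then show ?thesis by blast
qed

text \<open>Symmetry of \<open>Q\<close> makes the two change-of-basis matrices transposes of each
  other, hence orthogonal. This is the source of independence of the frame.\<close>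

lemma trace_orthonormal_pair:
  assumes "orthonormal_pair e f" "orthonormal_pair e' f'" "bilinear B"
  shows "B e' e' + B f' f' = B e e + B f f"
proof -
  define a b c d where abcd: "a = Q e' e" "b = Q e' f" "c = Q f' e" "d = Q f' f"
  have e': "e' = a *\<^sub>R e + b *\<^sub>R f" and f': "f' = c *\<^sub>R e + d *\<^sub>R f"
    unfolding abcd by (rule orthonormal_pair_expand[OF assms(1)])+
  have e: "e = a *\<^sub>R e' + c *\<^sub>R f'" and f: "f = b *\<^sub>R e' + d *\<^sub>R f'"
    unfolding abcd Q_commute[of _ e] Q_commute[of _ f]
    by (rule orthonormal_pair_expand[OF assms(2)])+
  have e'f': "Q e' e' = 1" "Q f' f' = 1" "Q e' f' = 0" "Q f' e' = 0"
    using assms(2) Q_commute[of f' e'] by (simp_all add: orthonormal_pair_def)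
  have "Q (a *\<^sub>R e' + c *\<^sub>R f') (a *\<^sub>R e' + c *\<^sub>R f') = a\<^sup>2 + c\<^sup>2"
    "Q (a *\<^sub>R e' + c *\<^sub>R f') (b *\<^sub>R e' + d *\<^sub>R f') = a * b + c * d"
    "Q (b *\<^sub>R e' + d *\<^sub>R f') (b *\<^sub>R e' + d *\<^sub>R f') = b\<^sup>2 + d\<^sup>2"
    by (simp_all add: Q_simps e'f' power2_eq_square)
  then have 1: "a\<^sup>2 + c\<^sup>2 = 1" "a * b + c * d = 0" "b\<^sup>2 + d\<^sup>2 = 1"
    using assms(1) unfolding e[symmetric] f[symmetric] by (simp_all add: orthonormal_pair_def)
  have "B e' e' + B f' f' =
      (a\<^sup>2 + c\<^sup>2) *\<^sub>R B e e + (a * b + c * d) *\<^sub>R (B e f + B f e) + (b\<^sup>2 + d\<^sup>2) *\<^sub>R B f f"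
    unfolding e' f'
    by (simp add: bilinear_ladd[OF assms(3)] bilinear_radd[OF assms(3)] bilinear_lmul[OF assms(3)]
        bilinear_rmul[OF assms(3)] algebra_simps power2_eq_square)
  then show ?thesis unfolding 1 by simp
qed

lemma A_trace:
  assumes "orthonormal_pair e f"
  shows "A e e + A f f = grad"
proof -
  have "A e e + A f f = grad + (grad - (fst e *\<^sub>R e + fst f *\<^sub>R f))"
    using assms by (simp add: A_def orthonormal_pair_def)
  then show ?thesis by (simp add: orthonormal_pair_grad[OF assms])
qed

lemma orthonormal_frame_pair:
  assumes "orthonormal_frame (carrier E1) g E" "fst x > 0"
  shows "orthonormal_pair ((1 / fst x) *\<^sub>R E (1, 0) x) ((1 / fst x) *\<^sub>R E (0, 1) x)"
proof -
  have "Q (E b x) (E c x) = (if b = c then (fst x)\<^sup>2 else 0)" if "b \<in> Basis" "c \<in> Basis" for b c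
  proof -
    have "g x (E b x) (E c x) = (if b = c then 1 else 0)"
      using assms that by (simp add: orthonormal_frame_def del: split_paired_All)
    then show ?thesis using assms(2) by (simp add: metric_eq split: if_splits)
  qed
  from this[of "(1, 0)" "(1, 0)"] this[of "(0, 1)" "(0, 1)"] this[of "(1, 0)" "(0, 1)"]
  show ?thesis
    using assms(2) by (simp add: orthonormal_pair_def Q_simps power2_eq_square Basis_prod_def)
qed

text \<open>An arbitrary frame has nonconstant coefficients in the left invariant fields. Their
  derivative can stay unspecified because it cancels in the tension.\<close>

lemma orthonormal_frame_coefficient:
  assumes "orthonormal_frame (carrier E1) g E" "fst x > 0" "b \<in> Basis"
  obtains c' where "((\<lambda>y. (1 / fst y) *\<^sub>R E b y) has_derivative c') (at x)"
proof -
  have "(E b has_derivative differential (E b) x) (at x)"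
    using assms by (intro smooth_on_has_derivative[of "carrier E1"]) (auto simp: orthonormal_frame_def)
  moreover have "((\<lambda>y. 1 / fst y) has_derivative (\<lambda>u. - fst u / (fst x)\<^sup>2)) (at x)"
    using assms(2) by (auto intro!: derivative_eq_intros simp: power2_eq_square)
  ultimately show ?thesis using has_derivative_scaleR that by blast
qed

text \<open>Supplies a concrete frame at which the quantified conditions \<open>harmonic\<close> and
  \<open>biharmonic\<close> are evaluated.\<close>

lemma orthonormal_frame_left_invariant:
  assumes "orthonormal_pair e f"
  shows "orthonormal_frame (carrier E1) g (\<lambda>b y. fst y *\<^sub>R (if b = (1, 0) then e else f))"
  unfolding orthonormal_frame_def
proof (intro conjI ballI)
  show "smooth_on (carrier E1) (\<lambda>y. fst y *\<^sub>R (if b = (1, 0) then e else f))" for b :: "real \<times> real"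
    unfolding smooth_on_def
    by (intro allI Ck_on_bounded_linear E1_open bounded_linear_scaleR_left[THEN bounded_linear_compose]
        bounded_linear_fst)
  fix x b c :: "real \<times> real" assume "x \<in> carrier E1" "b \<in> Basis" "c \<in> Basis"
  then show "g x (fst x *\<^sub>R (if b = (1, 0) then e else f)) (fst x *\<^sub>R (if c = (1, 0) then e else f)) =
      (if b = c then 1 else 0)"
    using assms Q_commute[of f e]
    by (auto simp: Basis_prod_def metric_eq Q_simps orthonormal_pair_def power2_eq_square)
qed

end

section \<open>Differentials of homomorphisms\<close>

lemma lie_hom_E1E:
  assumes "\<phi> \<in> lie_hom E1 G"
  shows "fst x > 0 \<Longrightarrow> \<phi> x \<in> carrier G"
    "fst x > 0 \<Longrightarrow> fst y > 0 \<Longrightarrow> \<phi> (x \<otimes>\<^bsub>E1\<^esub> y) = \<phi> x \<otimes>\<^bsub>G\<^esub> \<phi> y"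
    "fst x > 0 \<Longrightarrow> (\<phi> has_derivative differential \<phi> x) (at x)"
  using assms smooth_on_has_derivative[of "carrier E1" \<phi> x]
  by (auto simp: lie_hom_def hom_def Pi_def simp del: split_paired_All)

text \<open>Conjugation by \<open>(c, 0)\<close> stretches the vertical subgroup by
  \<open>c\<close>; this derivative compares both sides.\<close>

lemma has_derivative_vertical:
  assumes "(F has_derivative F') (at (a, 0))"
  shows "((\<lambda>b::real. F (a, c * b)) has_derivative (\<lambda>b. b *\<^sub>R c *\<^sub>R F' (0, 1))) (at 0)"
proof -
  have "((\<lambda>b. (a, c * b)) has_derivative (\<lambda>b. (0, c * b))) (at 0)"
    by (auto intro!: derivative_eq_intros)
  then have "((\<lambda>b. F (a, c * b)) has_derivative (\<lambda>b. F' (0, c * b))) (at 0)"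
    using has_derivative_compose[of "\<lambda>b. (a, c * b)" "\<lambda>b. (0, c * b)" 0 UNIV F F'] assms by simp
  moreover have "F' (0, c * b) = b *\<^sub>R c *\<^sub>R F' (0, 1)" for b
    using linear_scale[OF has_derivative_linear[OF assms], of "b * c" "(0, 1)"]
    by (simp add: mult.commute)
  ultimately show ?thesis by simp
qed

lemma has_derivative_left_translation:
  assumes "fst x > 0" "(F has_derivative F') (at x)"
  shows "((\<lambda>y. F (x \<otimes>\<^bsub>E1\<^esub> y)) has_derivative (\<lambda>u. F' (fst x *\<^sub>R u))) (at (1, 0))"
  using has_derivative_compose[OF has_derivative_E1_left_translation, of F F' "fst x" "(1, 0)" "snd x"] assms(2)
  by simp

text \<open>Differentiating the homomorphism law at the identity transports the differential to
  every point. The dichotomy for \<open>\<xi>\<close> comes from differentiating a conjugation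
  relation.\<close>

lemma lie_hom_E1_E1:
  assumes "\<phi> \<in> lie_hom E1 E1"
  obtains \<xi> where "linear \<xi>"
    "\<And>x. fst x > 0 \<Longrightarrow> (\<phi> has_derivative (\<lambda>u. fst (\<phi> x) *\<^sub>R \<xi> ((1 / fst x) *\<^sub>R u))) (at x)"
    "\<xi> (0, 1) = 0 \<or> (\<forall>u. fst (\<xi> u) = fst u)"
proof
  note hom = lie_hom_E1E[OF assms]
  let ?\<xi> = "differential \<phi> (1, 0)"
  have lin: "linear ?\<xi>" using hom(3)[of "(1, 0)"] has_derivative_linear by force
  then show "linear ?\<xi>" .
  show "(\<phi> has_derivative (\<lambda>u. fst (\<phi> x) *\<^sub>R ?\<xi> ((1 / fst x) *\<^sub>R u))) (at x)" if x: "fst x > 0" for x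
  proof -
    have "((\<lambda>y. \<phi> x \<otimes>\<^bsub>E1\<^esub> \<phi> y) has_derivative (\<lambda>u. fst (\<phi> x) *\<^sub>R ?\<xi> u)) (at (1, 0))"
      using has_derivative_compose[OF hom(3)[of "(1, 0)"] has_derivative_E1_left_translation,
          of "fst (\<phi> x)" "snd (\<phi> x)"] by simp
    then have "((\<lambda>y. \<phi> (x \<otimes>\<^bsub>E1\<^esub> y)) has_derivative (\<lambda>u. fst (\<phi> x) *\<^sub>R ?\<xi> u)) (at (1, 0))"
      by (rule has_derivative_transform_within_open[OF _ E1_open]) (use hom(2) x in auto)
    from has_derivative_unique[OF this has_derivative_left_translation[OF x hom(3)[OF x]]]
    have "fst (\<phi> x) *\<^sub>R ?\<xi> u = differential \<phi> x (fst x *\<^sub>R u)" for u by (rule fun_cong)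
    from this[of "(1 / fst x) *\<^sub>R _"] have "differential \<phi> x = (\<lambda>u. fst (\<phi> x) *\<^sub>R ?\<xi> ((1 / fst x) *\<^sub>R u))"
      using x by (simp add: fun_eq_iff del: split_paired_All)
    then show ?thesis using hom(3)[OF x] by simp
  qed
  have pos: "fst (\<phi> x) > 0" if "fst x > 0" for x using hom(1)[OF that] by simp
  \<comment> \<open>Both identities are the components of the image of
    \<open>(a, 0) (1, b) = (1, a b) (a, 0)\<close>.\<close>
  have conj: "fst (\<phi> (1, b)) = fst (\<phi> (1, a * b))"
    "fst (\<phi> (a, 0)) * snd (\<phi> (1, b)) + snd (\<phi> (a, 0)) =
      fst (\<phi> (1, a * b)) * snd (\<phi> (a, 0)) + snd (\<phi> (1, a * b))" if "a > 0" for a b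
  proof -
    have "\<phi> (a, 0) \<otimes>\<^bsub>E1\<^esub> \<phi> (1, b) = \<phi> (1, a * b) \<otimes>\<^bsub>E1\<^esub> \<phi> (a, 0)"
      using hom(2)[of "(a, 0)" "(1, b)"] hom(2)[of "(1, a * b)" "(a, 0)"] that by simp
    then show "fst (\<phi> (1, b)) = fst (\<phi> (1, a * b))"
      "fst (\<phi> (a, 0)) * snd (\<phi> (1, b)) + snd (\<phi> (a, 0)) =
        fst (\<phi> (1, a * b)) * snd (\<phi> (a, 0)) + snd (\<phi> (1, a * b))"
      using pos[of "(a, 0)"] that by auto
  qed
  have d: "((\<lambda>b. \<phi> (1, c * b)) has_derivative (\<lambda>b. b *\<^sub>R c *\<^sub>R ?\<xi> (0, 1))) (at 0)" for c
    by (rule has_derivative_vertical) (use hom(3) in simp)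
  \<comment> \<open>The first component along the vertical subgroup is unchanged by doubling
    \<open>b\<close>, so its derivative equals twice itself.\<close>
  have "(\<lambda>b. fst (b *\<^sub>R 1 *\<^sub>R ?\<xi> (0, 1))) = (\<lambda>b. fst (b *\<^sub>R 2 *\<^sub>R ?\<xi> (0, 1)))"
    by (rule has_derivative_unique[OF has_derivative_fst[OF d[of 1]]])
      (use conj(1)[of 2] has_derivative_fst[OF d[of 2]] in simp)
  from fun_cong[OF this, of 1] have fst0: "fst (?\<xi> (0, 1)) = 0" by simp
  have *: "fst (\<phi> (a, 0)) * snd (?\<xi> (0, 1)) = a * snd (?\<xi> (0, 1))" if "a > 0" for a
  proof -
    have "((\<lambda>b. fst (\<phi> (a, 0)) * snd (\<phi> (1, 1 * b)) + snd (\<phi> (a, 0))) has_derivative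
        (\<lambda>b. fst (\<phi> (a, 0)) * snd (b *\<^sub>R 1 *\<^sub>R ?\<xi> (0, 1)))) (at 0)"
      using d[of 1] by (auto intro!: derivative_eq_intros)
    moreover have "((\<lambda>b. fst (\<phi> (1, a * b)) * snd (\<phi> (a, 0)) + snd (\<phi> (1, a * b))) has_derivative
        (\<lambda>b. fst (b *\<^sub>R a *\<^sub>R ?\<xi> (0, 1)) * snd (\<phi> (a, 0)) + snd (b *\<^sub>R a *\<^sub>R ?\<xi> (0, 1)))) (at 0)"
      by (auto intro!: derivative_eq_intros d)
    ultimately have "(\<lambda>b. fst (\<phi> (a, 0)) * snd (b *\<^sub>R 1 *\<^sub>R ?\<xi> (0, 1))) =
        (\<lambda>b. fst (b *\<^sub>R a *\<^sub>R ?\<xi> (0, 1)) * snd (\<phi> (a, 0)) + snd (b *\<^sub>R a *\<^sub>R ?\<xi> (0, 1)))"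
      by (intro has_derivative_unique) (simp_all add: conj(2)[OF that])
    from fun_cong[OF this, of 1] show ?thesis by (simp add: fst0)
  qed
  \<comment> \<open>If the vertical derivative is nonzero, \<open>*\<close> gives
    \<open>fst (\<phi> (a, 0)) = a\<close>, and differentiating at \<open>1\<close> fixes the first
    coordinate.\<close>
  show "?\<xi> (0, 1) = 0 \<or> (\<forall>u. fst (?\<xi> u) = fst u)"
  proof (cases "snd (?\<xi> (0, 1)) = 0")
    case False
    have 1: "((\<lambda>a. fst (\<phi> (a, 0))) has_derivative (\<lambda>a. fst (?\<xi> (a, 0)))) (at 1)"
    proof -
      have "((\<lambda>a::real. (a, 0::real)) has_derivative (\<lambda>a. (a, 0))) (at 1)"
        by (auto intro!: derivative_eq_intros)
      from has_derivative_compose[OF this, of \<phi> ?\<xi>] hom(3)[of "(1, 0)"]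
      show ?thesis by (intro has_derivative_fst) simp
    qed
    have "((\<lambda>a. fst (\<phi> (a, 0))) has_derivative (\<lambda>a. a)) (at 1)"
      by (rule has_derivative_transform_within_open[OF has_derivative_ident open_greaterThan[of 0]])
        (use * False in auto)
    from fun_cong[OF has_derivative_unique[OF 1 this], of 1]
    have "fst (?\<xi> (1, 0)) = 1" by simp
    then show ?thesis using linear_real_prod_eq[OF lin] fst0
      by (metis add.right_neutral fst_add fst_scaleR mult.right_neutral mult_zero_right real_scaleR_def)
  qed (use fst0 in \<open>simp add: prod_eq_iff\<close>)
qed

text \<open>The target is abelian, so conjugate elements \<open>(1, b)\<close> and
  \<open>(1, 2 * b)\<close> have equal images and the vertical derivative vanishes.\<close>

lemma lie_hom_E1_real_line:
  assumes "\<zeta> \<in> lie_hom E1 real_line"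
  obtains \<kappa> where "\<And>x. fst x > 0 \<Longrightarrow> (\<zeta> has_derivative (\<lambda>u. \<kappa> * fst ((1 / fst x) *\<^sub>R u))) (at x)"
proof
  note hom = lie_hom_E1E[OF assms]
  let ?\<xi> = "differential \<zeta> (1, 0)"
  have lin: "linear ?\<xi>" using hom(3)[of "(1, 0)"] has_derivative_linear by force
  have d: "((\<lambda>b. \<zeta> (1, c * b)) has_derivative (\<lambda>b. b *\<^sub>R c *\<^sub>R ?\<xi> (0, 1))) (at 0)" for c
    by (rule has_derivative_vertical) (use hom(3) in simp)
  have "\<zeta> (1, 2 * b) = \<zeta> (1, b)" for b
    using hom(2)[of "(2, 0)" "(1, b)"] hom(2)[of "(1, 2 * b)" "(2, 0)"] by simp
  then have "(\<lambda>b. b *\<^sub>R 1 *\<^sub>R ?\<xi> (0, 1)) = (\<lambda>b. b *\<^sub>R 2 *\<^sub>R ?\<xi> (0, 1))"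
    using d[of 1] d[of 2] by (intro has_derivative_unique[of "\<lambda>b. \<zeta> (1, b)"]) simp_all
  from fun_cong[OF this, of 1] have 0: "?\<xi> u = ?\<xi> (1, 0) * fst u" for u
    using linear_real_prod_eq[OF lin, of u] by simp
  show "(\<zeta> has_derivative (\<lambda>u. ?\<xi> (1, 0) * fst ((1 / fst x) *\<^sub>R u))) (at x)" if x: "fst x > 0" for x
  proof -
    have "((\<lambda>y. \<zeta> x + \<zeta> y) has_derivative ?\<xi>) (at (1, 0))"
      using hom(3)[of "(1, 0)"] by (auto intro!: derivative_eq_intros)
    then have "((\<lambda>y. \<zeta> (x \<otimes>\<^bsub>E1\<^esub> y)) has_derivative ?\<xi>) (at (1, 0))"
      by (rule has_derivative_transform_within_open[OF _ E1_open]) (use hom(2) x in auto)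
    from has_derivative_unique[OF this has_derivative_left_translation[OF x hom(3)[OF x]]]
    have "?\<xi> u = differential \<zeta> x (fst x *\<^sub>R u)" for u by (rule fun_cong)
    from this[of "(1 / fst x) *\<^sub>R _"] have "differential \<zeta> x = (\<lambda>u. ?\<xi> ((1 / fst x) *\<^sub>R u))"
      using x by (simp add: fun_eq_iff del: split_paired_All)
    also have "\<dots> = (\<lambda>u. ?\<xi> (1, 0) * fst ((1 / fst x) *\<^sub>R u))" by (rule ext) (rule 0)
    finally show ?thesis using hom(3)[OF x] by simp
  qed
qed

text \<open>Writing \<open>i s\<close> as the product of \<open>i t\<close> and
  \<open>i (s - t)\<close> carries the derivative at \<open>0\<close> to \<open>t\<close>.\<close>

lemma lie_hom_real_line_E1:
  assumes "i \<in> lie_hom real_line E1"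
  obtains \<eta> where "\<And>t. fst (i t) > 0" "i 0 = (1, 0)"
    "\<And>t. (i has_derivative (\<lambda>s. fst (i t) *\<^sub>R s *\<^sub>R \<eta>)) (at t)"
proof
  have "i \<in> hom real_line E1" using assms by (simp add: lie_hom_def)
  then have pos: "fst (i t) > 0" and hom: "i (s + t) = i s \<otimes>\<^bsub>E1\<^esub> i t" for s t
    using hom_in_carrier[of i real_line E1 t] hom_mult[of i real_line E1 s t]
    by (simp_all only: E1_simps(1) real_line_simps(1,2) simp_thms)
  show "fst (i t) > 0" for t by (rule pos)
  show "i 0 = (1, 0)" using hom[of 0 0] pos[of 0] by (cases "i 0") auto
  have d: "(i has_derivative differential i t) (at t)" for t
    by (rule smooth_on_has_derivative[of "carrier real_line"])
      (use assms in \<open>auto simp: lie_hom_def\<close>)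
  let ?\<eta> = "differential i 0 1"
  show "(i has_derivative (\<lambda>s. fst (i t) *\<^sub>R s *\<^sub>R ?\<eta>)) (at t)" for t
  proof -
    have "((\<lambda>s. s - t) has_derivative (\<lambda>s. s)) (at t)" by (auto intro!: derivative_eq_intros)
    from has_derivative_compose[OF this, of i "differential i 0"] d[of 0]
    have "((\<lambda>s. i (s - t)) has_derivative differential i 0) (at t)" by simp
    from has_derivative_compose[OF this has_derivative_E1_left_translation, of "fst (i t)" "snd (i t)"]
    have *: "((\<lambda>s. i t \<otimes>\<^bsub>E1\<^esub> i (s - t)) has_derivative
        (\<lambda>s. fst (i t) *\<^sub>R differential i 0 s)) (at t)"
      by simp
    have **: "(\<lambda>s. i t \<otimes>\<^bsub>E1\<^esub> i (s - t)) = i"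
      by (simp only: hom[symmetric] diff_add_cancel add.commute[of t])
    have "(\<lambda>s. fst (i t) *\<^sub>R differential i 0 s) = (\<lambda>s. fst (i t) *\<^sub>R s *\<^sub>R ?\<eta>)"
      using linear_scale[OF has_derivative_linear[OF d[of 0]], of _ 1]
      by (metis mult.right_neutral real_scaleR_def)
    from *[unfolded this **] show ?thesis .
  qed
qed

section \<open>Tension and bitension of a homomorphism\<close>

text \<open>The homomorphism enters through its differential alone: \<open>\<xi>\<close>, extended
  left invariantly, is the pulled back Maurer-Cartan form.\<close>

locale E1_hom = M: E1_metric g + N: E1_metric h for g h +
  fixes \<phi> \<xi> :: "real \<times> real \<Rightarrow> real \<times> real"
  assumes linear_\<xi>: "linear \<xi>"
    and pos: "\<And>x. fst x > 0 \<Longrightarrow> fst (\<phi> x) > 0"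
    and deriv: "\<And>x. fst x > 0 \<Longrightarrow>
      (\<phi> has_derivative (\<lambda>u. fst (\<phi> x) *\<^sub>R \<xi> ((1 / fst x) *\<^sub>R u))) (at x)"
begin

lemmas \<xi>_simps = linear_add[OF linear_\<xi>] linear_diff[OF linear_\<xi>] linear_scale[OF linear_\<xi>]
  linear_0[OF linear_\<xi>]

text \<open>For an orthonormal pair, the trace of the pulled back form, twice the usual energy
  density.\<close>

definition energy :: "real \<times> real \<Rightarrow> real \<times> real \<Rightarrow> real" where
  "energy e f = N.Q (\<xi> e) (\<xi> e) + N.Q (\<xi> f) (\<xi> f)"

text \<open>The tension field of \<open>\<phi>\<close> at \<open>x\<close> is \<open>tension_vector e f\<close>, translated from the identity to
  \<open>\<phi> x\<close>; this does not depend on the orthonormal pair.\<close>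

definition tension_vector :: "real \<times> real \<Rightarrow> real \<times> real \<Rightarrow> real \<times> real" where
  "tension_vector e f = N.A (\<xi> e) (\<xi> e) + N.A (\<xi> f) (\<xi> f) - \<xi> M.grad"

lemma differential_eq:
  "fst x > 0 \<Longrightarrow> differential \<phi> x u = fst (\<phi> x) *\<^sub>R \<xi> ((1 / fst x) *\<^sub>R u)"
  by (simp add: differential_eqI[OF deriv])

lemma pullback_nabla_eq:
  assumes "\<And>y. fst y > 0 \<Longrightarrow> V y = fst (\<phi> y) *\<^sub>R v y" "(v has_derivative v') (at x)" "fst x > 0"
  shows "pullback_nabla h \<phi> X V x =
    fst (\<phi> x) *\<^sub>R (v' (X x) + N.A (\<xi> ((1 / fst x) *\<^sub>R X x)) (v x))"
  by (rule N.pullback_nabla_eq[OF E1_open]) (use assms pos deriv in auto)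

text \<open>The derivative \<open>c'\<close> of the coefficient occurs in both terms and cancels by
  linearity of \<open>\<xi>\<close>.\<close>

lemma nabla_differential_eq:
  assumes c': "((\<lambda>y. (1 / fst y) *\<^sub>R X y) has_derivative c') (at x)" and x: "fst x > 0"
  defines "c \<equiv> (1 / fst x) *\<^sub>R X x"
  shows "nabla_differential g h \<phi> X X x = fst (\<phi> x) *\<^sub>R (N.A (\<xi> c) (\<xi> c) - \<xi> (M.A c c))"
proof -
  have bl: "bounded_linear \<xi>" using linear_\<xi> by (rule linear_conv_bounded_linear[THEN iffD1])
  have 1: "pullback_nabla h \<phi> X (\<lambda>y. differential \<phi> y (X y)) x =
      fst (\<phi> x) *\<^sub>R (\<xi> (c' (X x)) + N.A (\<xi> c) (\<xi> c))"
    unfolding c_def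
    by (rule pullback_nabla_eq[OF _ bounded_linear.has_derivative[OF bl c'] x]) (rule differential_eq)
  have 2: "nabla g X X x = fst x *\<^sub>R (c' (X x) + M.A c c)"
    unfolding c_def by (rule M.nabla_eq[OF _ c' x]) simp
  show ?thesis
    unfolding nabla_differential_def 1 2 differential_eq[OF x]
    using x by (simp add: \<xi>_simps algebra_simps)
qed

lemma tension_eq:
  assumes E: "orthonormal_frame (carrier E1) g E" and x: "fst x > 0"
  shows "tension g h \<phi> E x =
    fst (\<phi> x) *\<^sub>R tension_vector ((1 / fst x) *\<^sub>R E (1, 0) x) ((1 / fst x) *\<^sub>R E (0, 1) x)"
proof -
  have "nabla_differential g h \<phi> (E b) (E b) x = fst (\<phi> x) *\<^sub>R
      (N.A (\<xi> ((1 / fst x) *\<^sub>R E b x)) (\<xi> ((1 / fst x) *\<^sub>R E b x))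
        - \<xi> (M.A ((1 / fst x) *\<^sub>R E b x) ((1 / fst x) *\<^sub>R E b x)))" if "b \<in> Basis" for b
    by (rule M.orthonormal_frame_coefficient[OF E x that]) (rule nabla_differential_eq[OF _ x])
  then show ?thesis
    unfolding tension_def sum_Basis_real_prod tension_vector_def
      M.A_trace[OF M.orthonormal_frame_pair[OF E x], symmetric]
    by (simp add: Basis_prod_def \<xi>_simps(1) scaleR_add_right scaleR_diff_right)
qed

lemma tension_vector_unique:
  assumes "M.orthonormal_pair e f" "M.orthonormal_pair e' f'"
  shows "tension_vector e' f' = tension_vector e f"
proof -
  have "bilinear (\<lambda>u v. N.A (\<xi> u) (\<xi> v))"
    unfolding bilinear_def linear_iff by (simp add: \<xi>_simps N.A_simps del: split_paired_All)
  from M.trace_orthonormal_pair[OF assms this] show ?thesis by (simp add: tension_vector_def)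
qed

text \<open>One direction evaluates the left invariant frame at the identity; the other moves any
  frame to the identity, where the trace does not depend on the pair.\<close>

lemma harmonic_iff:
  assumes ef: "M.orthonormal_pair e f"
  shows "harmonic (carrier E1) g h \<phi> \<longleftrightarrow> tension_vector e f = 0"
proof
  assume "harmonic (carrier E1) g h \<phi>"
  then have "tension g h \<phi> (\<lambda>b y. fst y *\<^sub>R (if b = (1, 0) then e else f)) (1, 0) = 0"
    using M.orthonormal_frame_left_invariant[OF ef] by (simp add: harmonic_def)
  then show "tension_vector e f = 0"
    using pos[of "(1, 0)"] by (simp add: tension_eq[OF M.orthonormal_frame_left_invariant[OF ef]])
next
  assume "tension_vector e f = 0"
  then show "harmonic (carrier E1) g h \<phi>"
    using tension_vector_unique[OF ef M.orthonormal_frame_pair]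
    by (simp add: harmonic_def tension_eq del: split_paired_All)
qed

text \<open>In a left invariant frame the tension has the constant coefficient \<open>w\<close>, so
  covariant derivatives reduce to \<open>N.A\<close>. The right-hand side is the curvature
  term.\<close>

lemma biharmonicD:
  assumes ef: "M.orthonormal_pair e f" and "biharmonic (carrier E1) g h \<phi>"
  defines "w \<equiv> tension_vector e f"
  shows "N.A (\<xi> e) (N.A (\<xi> e) w) + N.A (\<xi> f) (N.A (\<xi> f) w) - N.A (\<xi> M.grad) w =
    fst N.grad *\<^sub>R (energy e f *\<^sub>R w - N.Q w (\<xi> e) *\<^sub>R \<xi> e - N.Q w (\<xi> f) *\<^sub>R \<xi> f)"
proof -
  define p where "p b = (if b = (1, 0) then e else f)" for b :: "real \<times> real"
  have p: "p (1, 0) = e" "p (0, 1) = f" by (simp_all add: p_def)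
  let ?E = "\<lambda>b y. fst y *\<^sub>R p b"
  have E: "orthonormal_frame (carrier E1) g ?E"
    unfolding p_def by (rule M.orthonormal_frame_left_invariant[OF ef])
  let ?x = "(1, 0) :: real \<times> real"
  have x: "fst ?x > 0" by simp
  have \<tau>: "tension g h \<phi> ?E y = fst (\<phi> y) *\<^sub>R w" if "fst y > 0" for y
    unfolding tension_eq[OF E that] w_def using that by (simp add: p)
  \<comment> \<open>Needed on the whole half plane, since \<open>2\<close> differentiates this field
    again.\<close>
  have 1: "pullback_nabla h \<phi> (?E b) (tension g h \<phi> ?E) y =
      fst (\<phi> y) *\<^sub>R N.A (\<xi> (p b)) w" if "fst y > 0" for b y
    using pullback_nabla_eq[OF \<tau> has_derivative_const that] that by simp
  have 2: "pullback_nabla h \<phi> (?E b) (pullback_nabla h \<phi> (?E b) (tension g h \<phi> ?E)) ?x =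
      fst (\<phi> ?x) *\<^sub>R N.A (\<xi> (p b)) (N.A (\<xi> (p b)) w)" for b
    using pullback_nabla_eq[OF 1 has_derivative_const x] by simp
  have "nabla g (?E b) (?E b) ?x = M.A (p b) (p b)" for b
    using M.nabla_eq[OF _ has_derivative_const x, of "?E b" "p b"] by simp
  then have 3: "pullback_nabla h \<phi> (nabla g (?E b) (?E b)) (tension g h \<phi> ?E) ?x =
      fst (\<phi> ?x) *\<^sub>R N.A (\<xi> (M.A (p b) (p b))) w" for b
    using pullback_nabla_eq[OF \<tau> has_derivative_const x] by simp
  have 4: "curvature h (\<phi> ?x) (tension g h \<phi> ?E ?x) (differential \<phi> ?x (?E b ?x))
      (differential \<phi> ?x (?E b ?x)) = fst (\<phi> ?x) *\<^sub>R (- fst N.grad) *\<^sub>R (N.Q (\<xi> (p b)) (\<xi> (p b)) *\<^sub>R w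
         - N.Q w (\<xi> (p b)) *\<^sub>R \<xi> (p b))" for b
    unfolding N.curvature_eq[OF pos[OF x]] \<tau>[OF x] differential_eq[OF x]
    using pos[OF x] by (simp add: N.Q_simps power2_eq_square algebra_simps)
  have "bitension g h \<phi> ?E ?x = 0"
    using assms(2) E by (simp add: biharmonic_def)
  then have "fst (\<phi> ?x) *\<^sub>R (N.A (\<xi> e) (N.A (\<xi> e) w) + N.A (\<xi> f) (N.A (\<xi> f) w)
      - N.A (\<xi> (M.A e e) + \<xi> (M.A f f)) w
      - fst N.grad *\<^sub>R (energy e f *\<^sub>R w - N.Q w (\<xi> e) *\<^sub>R \<xi> e - N.Q w (\<xi> f) *\<^sub>R \<xi> f)) = 0"
    unfolding bitension_def sum_Basis_real_prod pullback_nabla2_def 2 3 4 p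
    by (simp add: energy_def N.A_simps algebra_simps)
  then show ?thesis
    using pos[OF x] by (simp add: M.A_trace[OF ef] flip: \<xi>_simps(1))
qed

lemma rank_one_tension_vector:
  assumes ef: "M.orthonormal_pair e f" and "\<And>u. \<xi> u = fst u *\<^sub>R \<eta>"
  shows "tension_vector e f = fst M.grad *\<^sub>R (N.A \<eta> \<eta> - \<eta>)"
  unfolding tension_vector_def assms(2) M.orthonormal_pair_fst[OF ef, symmetric]
  by (simp add: N.A_simps algebra_simps power2_eq_square)

lemma rank_one_not_harmonic:
  assumes ef: "M.orthonormal_pair e f" and "\<And>u. \<xi> u = fst u *\<^sub>R \<eta>" "tension_vector e f = 0"
  shows "\<eta> = 0"
proof -
  have "N.A \<eta> \<eta> - \<eta> = 0"
    using assms(3) M.fst_grad_pos unfolding rank_one_tension_vector[OF assms(1,2)] by simp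
  then have "N.Q (N.A \<eta> \<eta> - \<eta>) \<eta> = 0" by (simp add: N.Q_simps)
  then show ?thesis by (simp add: N.A_def N.Q_simps N.Q_zeroD)
qed

section \<open>Homomorphisms whose differential preserves the first coordinate\<close>

context
  assumes fst_\<xi>: "\<And>u. fst (\<xi> u) = fst u"
begin

text \<open>Since \<open>fst (\<xi> u) = fst u\<close>, the subtracted parts of \<open>N.A\<close>
  sum to a second copy of \<open>\<xi> M.grad\<close>.\<close>

lemma fst_\<xi>_tension_vector:
  assumes "M.orthonormal_pair e f"
  shows "tension_vector e f = energy e f *\<^sub>R N.grad - 2 *\<^sub>R \<xi> M.grad"
proof -
  have "\<xi> M.grad = fst e *\<^sub>R \<xi> e + fst f *\<^sub>R \<xi> f"
    by (simp flip: M.orthonormal_pair_grad[OF assms] add: \<xi>_simps)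
  then show ?thesis
    by (simp add: tension_vector_def energy_def N.A_def fst_\<xi> scaleR_2 algebra_simps flip: scaleR_scaleR mult_2)
qed

lemma energy_pos:
  assumes "M.orthonormal_pair e f"
  shows "energy e f > 0"
proof -
  have "\<not> (\<xi> e = 0 \<and> \<xi> f = 0)"
    using M.orthonormal_pair_fst[OF assms] M.fst_grad_pos fst_\<xi>[of e] fst_\<xi>[of f] by auto
  then show ?thesis
    using N.Q_nonneg[of "\<xi> e"] N.Q_nonneg[of "\<xi> f"] N.Q_pos[of "\<xi> e"] N.Q_pos[of "\<xi> f"]
    by (auto simp: energy_def intro: add_pos_nonneg add_nonneg_pos)
qed

text \<open>Harmonicity makes \<open>grad\<close> an eigenvector of the pulled back form with eigenvalue half of the
  trace; in dimension two the form is then a multiple of the metric.\<close>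

lemma harmonic_imp_homothety:
  assumes ef: "M.orthonormal_pair e f" and "tension_vector e f = 0"
  shows "N.Q (\<xi> u) (\<xi> v) = energy e f / 2 * M.Q u v"
proof -
  note ef' = ef[unfolded M.orthonormal_pair_def]
  \<comment> \<open>The trace-free part of the pulled back form.\<close>
  define Z where "Z u v = N.Q (\<xi> u) (\<xi> v) - energy e f / 2 * M.Q u v" for u v
  have Z_simps: "Z (u + u') v = Z u v + Z u' v" "Z v (u + u') = Z v u + Z v u'"
    "Z (c *\<^sub>R u) v = c * Z u v" "Z v (c *\<^sub>R u) = c * Z v u" "Z u v = Z v u" for u u' v c
    by (simp_all add: Z_def \<xi>_simps N.Q_simps M.Q_simps N.Q_commute[of "\<xi> v"] M.Q_commute[of v] algebra_simps)
  have "\<xi> M.grad = (energy e f / 2) *\<^sub>R N.grad"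
    using assms(2) unfolding fst_\<xi>_tension_vector[OF ef] by (simp add: prod_eq_iff field_simps)
  then have "Z M.grad u = 0" for u by (simp add: Z_def N.Q_simps fst_\<xi>)
  then have 1: "fst e * Z e u + fst f * Z f u = 0" for u
    by (simp flip: M.orthonormal_pair_grad[OF ef] add: Z_simps(1-4))
  have 2: "Z e e + Z f f = 0"
    using ef' by (simp add: Z_def energy_def)
  have 3: "Z f e = Z e f" by (rule Z_simps(5))
  have 4: "(fst e)\<^sup>2 + (fst f)\<^sup>2 > 0" using M.orthonormal_pair_fst[OF ef] M.fst_grad_pos by simp
  \<comment> \<open>A symmetric trace-free form on the plane with a nonzero vector in its kernel
    vanishes.\<close>
  have "((fst e)\<^sup>2 + (fst f)\<^sup>2) * Z e e = 0" "((fst e)\<^sup>2 + (fst f)\<^sup>2) * Z e f = 0"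
    using 1[of e] 1[of f] 2 3 by algebra+
  then have "Z e e = 0" "Z e f = 0" "Z f f = 0" "Z f e = 0" using 2 3 4 by auto
  then have "Z (M.Q u e *\<^sub>R e + M.Q u f *\<^sub>R f) (M.Q v e *\<^sub>R e + M.Q v f *\<^sub>R f) = 0"
    by (simp add: Z_simps(1-4))
  then show ?thesis
    by (simp flip: M.orthonormal_pair_expand[OF ef] add: Z_def)
qed

text \<open>The bitension is a multiple of the tension \<open>w\<close>, by the factor
  \<open>2 (energy e f * fst N.grad - fst M.grad)\<close>. By the equality case of the Cauchy-Schwarz inequality, this
  factor vanishes only if \<open>\<xi>\<close> is degenerate.\<close>

lemma biharmonic_imp_harmonic:
  assumes ef: "M.orthonormal_pair e f" and "biharmonic (carrier E1) g h \<phi>" and inj: "inj \<xi>"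
  shows "tension_vector e f = 0"
proof (rule ccontr)
  define w t m where "w = tension_vector e f" and "t = energy e f" and "m = \<xi> M.grad"
  assume "tension_vector e f \<noteq> 0"
  then have w0: "w \<noteq> 0" by (simp add: w_def)
  have w: "w = t *\<^sub>R N.grad - 2 *\<^sub>R m"
    unfolding w_def t_def m_def by (rule fst_\<xi>_tension_vector[OF ef])
  have m: "m = fst e *\<^sub>R \<xi> e + fst f *\<^sub>R \<xi> f"
    unfolding m_def by (simp flip: M.orthonormal_pair_grad[OF ef] add: \<xi>_simps)
  have fst_m: "fst m = fst M.grad" by (simp add: m_def fst_\<xi>)
  have AA: "N.A (\<xi> u) (N.A (\<xi> u) w) = (N.Q (\<xi> u) w * fst u - fst w * N.Q (\<xi> u) (\<xi> u)) *\<^sub>R N.grad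
      - (N.Q (\<xi> u) w * fst N.grad) *\<^sub>R \<xi> u + (fst w * fst u) *\<^sub>R \<xi> u" for u
    by (simp add: N.A_def N.Q_simps fst_\<xi> algebra_simps)
  have "N.A (\<xi> e) (N.A (\<xi> e) w) + N.A (\<xi> f) (N.A (\<xi> f) w) =
      (N.Q m w - fst w * t) *\<^sub>R N.grad + fst w *\<^sub>R m
      - fst N.grad *\<^sub>R (N.Q w (\<xi> e) *\<^sub>R \<xi> e + N.Q w (\<xi> f) *\<^sub>R \<xi> f)"
    unfolding AA m t_def energy_def
    by (simp add: N.Q_simps N.Q_commute[of w] algebra_simps)
  then have "(N.Q m w - fst w * t) *\<^sub>R N.grad + fst w *\<^sub>R m - N.A m w = (fst N.grad * t) *\<^sub>R w"
    using biharmonicD[OF ef assms(2)] by (simp flip: w_def t_def m_def add: algebra_simps)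
  \<comment> \<open>Expanding \<open>N.A m w\<close> cancels the terms in \<open>N.Q m w\<close>;
    the rest is \<open>- fst w\<close> times \<open>w\<close> itself.\<close>
  then have "- fst w *\<^sub>R (t *\<^sub>R N.grad - 2 *\<^sub>R m) = (fst N.grad * t) *\<^sub>R w"
    by (simp add: N.A_def algebra_simps scaleR_2 flip: mult_2)
  then have "(fst w + fst N.grad * t) *\<^sub>R w = 0"
    unfolding w[symmetric] scaleR_add_left by (metis add.right_inverse scaleR_minus_left)
  then have "fst w + fst N.grad * t = 0" using w0 by simp
  then have "t * fst N.grad = fst M.grad" by (simp add: w fst_m)
  also have "\<dots> = (fst e)\<^sup>2 + (fst f)\<^sup>2" by (rule M.orthonormal_pair_fst[OF ef, symmetric])
  finally have sum: "N.Q (\<xi> e) (\<xi> e) * fst N.grad - (fst e)\<^sup>2 + (N.Q (\<xi> f) (\<xi> f) * fst N.grad - (fst f)\<^sup>2) = 0"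
    by (simp add: t_def energy_def algebra_simps)
  \<comment> \<open>\<open>r u\<close> is \<open>fst N.grad\<close> times the part of
    \<open>\<xi> u\<close> orthogonal to \<open>N.grad\<close>. Its square measures the
    Cauchy-Schwarz defect, and by \<open>sum\<close> the two defects add up to zero.\<close>
  define r where "r u = fst N.grad *\<^sub>R \<xi> u - fst u *\<^sub>R N.grad" for u
  have r: "N.Q (r u) (r u) = fst N.grad * (N.Q (\<xi> u) (\<xi> u) * fst N.grad - (fst u)\<^sup>2)" for u
    by (simp add: r_def N.Q_simps fst_\<xi> algebra_simps power2_eq_square)
  have "N.Q (r e) (r e) + N.Q (r f) (r f) = 0"
    using sum unfolding r by (metis distrib_left mult_zero_right)
  then have "r e = 0" "r f = 0"
    using N.Q_nonneg[of "r e"] N.Q_nonneg[of "r f"] N.Q_zeroD by (metis add_nonneg_eq_0_iff)+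
  \<comment> \<open>Both \<open>\<xi> e\<close> and \<open>\<xi> f\<close> are now multiples of
    \<open>N.grad\<close>, which yields a kernel vector of \<open>\<xi>\<close>.\<close>
  then have "fst f *\<^sub>R r e - fst e *\<^sub>R r f = 0" by simp
  then have "fst N.grad *\<^sub>R \<xi> (fst f *\<^sub>R e - fst e *\<^sub>R f) = \<xi> 0"
    by (simp add: r_def \<xi>_simps algebra_simps)
  then have "\<xi> (fst f *\<^sub>R e - fst e *\<^sub>R f) = \<xi> 0" using N.fst_grad_pos by (simp add: \<xi>_simps(4))
  then have 0: "fst f *\<^sub>R e - fst e *\<^sub>R f = 0" using inj by (rule injD[rotated])
  have "M.Q (fst f *\<^sub>R e - fst e *\<^sub>R f) e = 0" "M.Q (fst f *\<^sub>R e - fst e *\<^sub>R f) f = 0"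
    unfolding 0 by (simp_all add: M.Q_simps)
  then have "fst f = 0" "fst e = 0"
    using ef by (simp_all add: M.orthonormal_pair_def M.Q_simps M.Q_commute[of f e])
  then show False using M.orthonormal_pair_fst[OF ef] M.fst_grad_pos by simp
qed

end

end

lemma E1_zero_derivative_constant:
  fixes f :: "real \<times> real \<Rightarrow> 'a::real_normed_vector"
  assumes "\<And>x. fst x > 0 \<Longrightarrow> (f has_derivative (\<lambda>_. 0)) (at x)"
  shows "f constant_on carrier E1"
proof -
  have "carrier E1 = {0<..} \<times> UNIV" by (auto simp: E1_def)
  then have "convex (carrier E1)" by (simp add: convex_Times)
  moreover have "(f has_derivative (\<lambda>_. 0)) (at x within carrier E1)" if "x \<in> carrier E1" for x
    using assms[of x] that by (simp add: has_derivative_at_withinI)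
  ultimately have "\<exists>c. \<forall>x\<in>carrier E1. f x = c" by (rule has_derivative_zero_constant)
  then show ?thesis by (simp only: constant_on_def)
qed

section \<open>One-parameter groups and real valued homomorphisms\<close>

lemma normal_part_eqI:
  assumes "bilinear (h (\<phi> x))" "\<And>v. v \<noteq> 0 \<Longrightarrow> h (\<phi> x) v v > 0" "linear (differential \<phi> x)"
    and "\<And>u. h (\<phi> x) (differential \<phi> x u) v = 0"
  shows "normal_part h \<phi> x v = v"
  unfolding normal_part_def
proof (rule the_equality)
  show "(\<exists>u. v = differential \<phi> x u + v) \<and> (\<forall>u. h (\<phi> x) (differential \<phi> x u) v = 0)"
    using assms(4) linear_0[OF assms(3)] by (auto intro!: exI[of _ 0])
  fix w assume w: "(\<exists>u. v = differential \<phi> x u + w) \<and> (\<forall>u. h (\<phi> x) (differential \<phi> x u) w = 0)"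
  then obtain u where u: "v = differential \<phi> x u + w" by blast
  have "h (\<phi> x) (differential \<phi> x u) (differential \<phi> x u) = 0"
    using assms(4)[of u] w by (simp add: u bilinear_radd[OF assms(1)])
  then show "w = v" using assms(2)[of "differential \<phi> x u"] u by fastforce
qed

text \<open>For a unit vector, \<open>A v v\<close> is \<open>grad - fst v *\<^sub>R v\<close>,
  which vanishes exactly when \<open>v\<close> is parallel to \<open>grad\<close>.\<close>

lemma (in E1_metric) A_self_eq_0_iff:
  assumes "Q v v = 1"
  shows "A v v = 0 \<longleftrightarrow> Q v (0, 1) = 0"
proof
  assume "A v v = 0"
  then have grad: "grad = fst v *\<^sub>R v" using assms by (simp add: A_def)
  have "fst v * Q v (0, 1) = Q grad (0, 1)" unfolding grad by (simp add: Q_simps)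
  moreover have "fst v \<noteq> 0" using fst_grad_pos by (subst (asm) grad) auto
  ultimately show "Q v (0, 1) = 0" by simp
next
  assume v: "Q v (0, 1) = 0"
  have "Q (0, 1) (0, 1) > 0" by (rule Q_pos) (simp add: zero_prod_def)
  then have "orthonormal_pair v ((1 / sqrt (Q (0, 1) (0, 1))) *\<^sub>R (0, 1))"
    using v assms by (simp add: orthonormal_pair_def Q_simps del: scaleR_Pair)
  from orthonormal_pair_expand[OF this, of "A v v"] show "A v v = 0"
    using v assms by (simp add: A_def Q_simps del: scaleR_Pair)
qed

text \<open>A unit field on the line squares to one; differentiating the square shows that it is
  constant.\<close>

lemma orthonormal_frame_real:
  assumes "orthonormal_frame (carrier real_line) flat_metric E"
  shows "E 1 t * E 1 t = 1" "(E 1 has_derivative (\<lambda>_. 0)) (at t)"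
proof -
  show sq: "E 1 t * E 1 t = 1" for t
    using assms by (simp add: orthonormal_frame_def flat_metric_def)
  have d: "(E 1 has_derivative differential (E 1) t) (at t)"
    using assms by (intro smooth_on_has_derivative[of "carrier real_line"]) (auto simp: orthonormal_frame_def)
  have "((\<lambda>t. E 1 t * E 1 t) has_derivative
      (\<lambda>u. E 1 t * differential (E 1) t u + differential (E 1) t u * E 1 t)) (at t)"
    by (rule has_derivative_mult[OF d d])
  then have "(\<lambda>u. E 1 t * differential (E 1) t u + differential (E 1) t u * E 1 t) = (\<lambda>_. 0)"
    unfolding sq by (rule has_derivative_unique[OF _ has_derivative_const])
  then have "E 1 t * differential (E 1) t u = 0" for u by (auto simp: fun_eq_iff mult.commute)
  moreover have "E 1 t \<noteq> 0" using sq[of t] by auto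
  ultimately have "differential (E 1) t = (\<lambda>_. 0)" by (simp add: fun_eq_iff)
  then show "(E 1 has_derivative (\<lambda>_. 0)) (at t)" using d by simp
qed

lemma (in E1_metric) minimal_iff:
  assumes "i \<in> lie_hom real_line E1" "riemannian_immersion (carrier real_line) flat_metric g i"
  shows "minimal (carrier real_line) flat_metric g i \<longleftrightarrow>
    (\<forall>t. \<forall>z\<in>derived_algebra E1. g \<one>\<^bsub>E1\<^esub> (differential i 0 t) z = 0)"
proof -
  obtain v where pos: "\<And>t. fst (i t) > 0" and i0: "i 0 = (1, 0)"
    and d: "\<And>t. (i has_derivative (\<lambda>s. fst (i t) *\<^sub>R s *\<^sub>R v)) (at t)"
    using lie_hom_real_line_E1[OF assms(1)] by metis
  have di: "differential i t s = fst (i t) *\<^sub>R s *\<^sub>R v" for t s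
    by (simp add: differential_eqI[OF d])
  have "pullback_metric g i 0 1 1 = flat_metric (0::real) 1 1"
    using assms(2) by (simp add: riemannian_immersion_def)
  then have unit: "Q v v = 1" by (simp add: pullback_metric_def di i0 flat_metric_def flip: Q_def)
  have H: "mean_curvature g i E t = fst (i t) *\<^sub>R A v v"
    if "orthonormal_frame (carrier real_line) flat_metric E" for E t
  proof -
    note E = orthonormal_frame_real[OF that]
    have "pullback_nabla g i (E 1) (\<lambda>y. differential i y (E 1 y)) t =
        fst (i t) *\<^sub>R (0 *\<^sub>R v + A (E 1 t *\<^sub>R v) (E 1 t *\<^sub>R v))"
      by (rule pullback_nabla_eq[OF open_UNIV UNIV_I di d pos has_derivative_scaleR_left[OF E(2)]])
    also have "\<dots> = fst (i t) *\<^sub>R A v v" using E(1)[of t] by (simp add: A_simps)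
    finally have *: "pullback_nabla g i (E 1) (\<lambda>y. differential i y (E 1 y)) t = fst (i t) *\<^sub>R A v v" .
    \<comment> \<open>For the unit vector \<open>v\<close>, \<open>A v v\<close> is orthogonal to
      \<open>v\<close>, so the projection changes nothing.\<close>
    have "normal_part g i t (fst (i t) *\<^sub>R A v v) = fst (i t) *\<^sub>R A v v"
    proof (rule normal_part_eqI)
      show "bilinear (g (i t))" "\<And>v. v \<noteq> 0 \<Longrightarrow> g (i t) v v > 0"
        using riem pos by (simp_all add: riemannian_metric_def del: split_paired_All)
      show "linear (differential i t)"
        using d by (metis di ext has_derivative_linear)
      show "g (i t) (differential i t u) (fst (i t) *\<^sub>R A v v) = 0" for u
        by (simp add: metric_eq pos di Q_simps A_def unit)
    qed
    then show ?thesis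
      by (simp add: * mean_curvature_def second_fundamental_form_def)
  qed
  \<comment> \<open>An actual frame, so that minimality has consequences.\<close>
  have "orthonormal_frame (carrier real_line) flat_metric (\<lambda>_ _. 1)"
    by (auto simp: orthonormal_frame_def flat_metric_def smooth_on_def real_line_def intro!: Ck_on_const)
  then have "minimal (carrier real_line) flat_metric g i \<longleftrightarrow> (\<forall>t. fst (i t) *\<^sub>R A v v = 0)"
    unfolding minimal_def using H by auto
  also have "\<dots> \<longleftrightarrow> A v v = 0" using pos by (metis less_irrefl scaleR_eq_0_iff)
  also have "\<dots> \<longleftrightarrow> Q v (0, 1) = 0" by (rule A_self_eq_0_iff[OF unit])
  also have "\<dots> \<longleftrightarrow> (\<forall>s. s * Q v (0, 1) = 0)" by (metis mult_1 mult_zero_right)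
  also have "\<dots> \<longleftrightarrow> (\<forall>t s. g (1, 0) (differential i 0 t) (0, s) = 0)"
  proof -
    have "g (1, 0) (differential i 0 t) (0, s) = t * (s * Q v (0, 1))" for t s
      using Q_simps(6)[of v s "(0, 1)"] by (simp add: di i0 Q_simps flip: Q_def)
    then show ?thesis by (metis mult_1 mult_zero_right)
  qed
  finally show ?thesis by (simp add: derived_algebra_E1)
qed

section \<open>Tension and biharmonicity of real valued homomorphisms\<close>

context E1_metric
begin

context
  fixes \<zeta> :: "real \<times> real \<Rightarrow> real" and \<kappa> :: real
  assumes \<zeta>: "\<And>x. fst x > 0 \<Longrightarrow> (\<zeta> has_derivative (\<lambda>u. \<kappa> * fst ((1 / fst x) *\<^sub>R u))) (at x)"
begin

lemma tension_function:
  assumes E: "orthonormal_frame (carrier E1) g E" and x: "fst x > 0"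
  shows "tension g flat_metric \<zeta> E x = - \<kappa> * fst grad"
proof -
  have d: "differential \<zeta> x u = \<kappa> * fst ((1 / fst x) *\<^sub>R u)" if "fst x > 0" for x u
    by (simp add: differential_eqI[OF \<zeta>[OF that]])
  have "nabla_differential g flat_metric \<zeta> (E b) (E b) x =
      - \<kappa> * fst (A ((1 / fst x) *\<^sub>R E b x) ((1 / fst x) *\<^sub>R E b x))" if b: "b \<in> Basis" for b
  proof -
    obtain c' where c': "((\<lambda>y. (1 / fst y) *\<^sub>R E b y) has_derivative c') (at x)"
      using orthonormal_frame_coefficient[OF E x b] .
    have 1: "nabla g (E b) (E b) x =
        fst x *\<^sub>R (c' (E b x) + A ((1 / fst x) *\<^sub>R E b x) ((1 / fst x) *\<^sub>R E b x))"
      by (rule nabla_eq[OF _ c' x]) simp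
    have "((\<lambda>y. differential \<zeta> y (E b y)) has_derivative (\<lambda>u. \<kappa> * fst (c' u))) (at x)"
      by (rule has_derivative_transform_within_open[OF
            has_derivative_mult_right[OF has_derivative_fst[OF c']] E1_open])
        (use x d in auto)
    then show ?thesis
      unfolding nabla_differential_def pullback_nabla_def 1 d[OF x]
      using x by (simp add: differential_eqI algebra_simps)
  qed
  then have "tension g flat_metric \<zeta> E x =
      - \<kappa> * fst (A ((1 / fst x) *\<^sub>R E (1, 0) x) ((1 / fst x) *\<^sub>R E (1, 0) x)
        + A ((1 / fst x) *\<^sub>R E (0, 1) x) ((1 / fst x) *\<^sub>R E (0, 1) x))"
    unfolding tension_def sum_Basis_real_prod by (simp add: Basis_prod_def algebra_simps)
  then show ?thesis by (simp only: A_trace[OF orthonormal_frame_pair[OF E x]])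
qed

text \<open>The tension is a constant function by \<open>tension_function\<close> and the target is
  flat, so every term of the bitension vanishes.\<close>

lemma biharmonic_function: "biharmonic (carrier E1) g flat_metric \<zeta>"
  unfolding biharmonic_def
proof (intro allI impI ballI)
  fix E x assume E: "orthonormal_frame (carrier E1) g E" and x: "x \<in> carrier E1"
  have 1: "pullback_nabla flat_metric \<zeta> X V y = 0"
    if "\<And>z. fst z > 0 \<Longrightarrow> V z = c" "fst y > 0" for X V c y
  proof -
    have "(V has_derivative (\<lambda>_. 0)) (at y)"
      by (rule has_derivative_transform_within_open[OF has_derivative_const E1_open])
        (use that in auto)
    then show ?thesis by (simp add: pullback_nabla_def differential_eqI)
  qed
  have "pullback_nabla flat_metric \<zeta> X (tension g flat_metric \<zeta> E) y = 0" if "fst y > 0" for X y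
    using 1[OF tension_function[OF E] that] .
  then show "bitension g flat_metric \<zeta> E x = 0"
    using x by (simp add: bitension_def pullback_nabla2_def 1[of _ 0])
qed

lemma harmonic_function_constant:
  assumes "harmonic (carrier E1) g flat_metric \<zeta>"
  shows "\<zeta> constant_on carrier E1"
proof -
  obtain e f where ef: "orthonormal_pair e f" using orthonormal_pair_exists by blast
  have "- \<kappa> * fst grad = 0"
    using assms orthonormal_frame_left_invariant[OF ef]
      tension_function[OF orthonormal_frame_left_invariant[OF ef], of "(1, 0)"]
    by (simp add: harmonic_def)
  then have "\<kappa> = 0" using fst_grad_pos by simp
  then show ?thesis using \<zeta> by (intro E1_zero_derivative_constant) simp
qed

end

end

section \<open>Factorisation through the real line\<close>

lemma lie_hom_ln: "(\<lambda>x. k * ln (fst x)) \<in> lie_hom E1 real_line"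
proof -
  have d: "((\<lambda>x. k * ln (fst x)) has_derivative (\<lambda>u. k * (inverse (fst x) * fst u))) (at x)"
    if "x \<in> carrier E1" for x
    using that by (auto intro!: derivative_eq_intros simp: field_simps)
  have *: "Ck_on m (carrier E1) (\<lambda>x. k * (inverse (fst x) * fst u))" for u :: "real \<times> real" and m
    using E1_open
    by (intro Ck_on_mult Ck_on_const Ck_on_inverse Ck_on_bounded_linear bounded_linear_fst) auto
  have "Ck_on (Suc m) (carrier E1) (\<lambda>x. k * ln (fst x))" for m
    by (rule Ck_on_SucI[OF E1_open d *])
  then have "smooth_on (carrier E1) (\<lambda>x. k * ln (fst x))"
    unfolding smooth_on_def using Ck_on_Suc_imp by blast
  then show ?thesis
    by (auto simp: lie_hom_def hom_def ln_mult algebra_simps)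
qed

text \<open>Bootstrapping: the derivative is linear in \<open>i\<close>, so each degree of
  smoothness gives the next.\<close>

lemma Ck_on_exponential_curve:
  fixes i :: "real \<Rightarrow> real \<times> real"
  assumes d: "\<And>t. (i has_derivative (\<lambda>s. fst (i t) *\<^sub>R s *\<^sub>R v)) (at t)"
  shows "Ck_on m UNIV i"
proof (induction m)
  case 0
  then show ?case
    using d by (auto intro!: continuous_at_imp_continuous_on has_derivative_continuous)
next
  case (Suc m)
  have "bounded_linear (\<lambda>p :: real \<times> real. fst p *\<^sub>R s *\<^sub>R v)" for s
    by (intro bounded_linear_scaleR_left[THEN bounded_linear_compose] bounded_linear_fst)
  from Ck_on_linear_comp[OF open_UNIV this Suc] show ?case
    by (rule Ck_on_SucI[OF open_UNIV d])
qed

text \<open>A homomorphism that kills the derived algebra factors through \<open>ln \<circ> fst\<close>; rescaling the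
  parameter of the resulting one-parameter group to unit speed gives the immersion.\<close>

lemma (in E1_metric) factor_through_real_line:
  assumes \<phi>: "\<phi> \<in> lie_hom E1 E1" and \<xi>: "\<And>u. \<xi> u = fst u *\<^sub>R \<eta>" "\<eta> \<noteq> 0"
    and deriv: "\<And>x. fst x > 0 \<Longrightarrow>
      (\<phi> has_derivative (\<lambda>u. fst (\<phi> x) *\<^sub>R \<xi> ((1 / fst x) *\<^sub>R u))) (at x)"
  shows "\<exists>i\<in>lie_hom real_line E1. \<exists>\<zeta>\<in>lie_hom E1 real_line.
    riemannian_immersion (carrier real_line) flat_metric g i \<and> (\<forall>x\<in>carrier E1. \<phi> x = i (\<zeta> x))"
proof -
  note hom = lie_hom_E1E[OF \<phi>]
  define k where "k = sqrt (Q \<eta> \<eta>)"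
  have k: "k > 0" "k * k = Q \<eta> \<eta>" using Q_pos[OF \<xi>(2)] by (simp_all add: k_def)
  then have "k \<noteq> 0" by simp
  define v where "v = (1 / k) *\<^sub>R \<eta>"
  \<comment> \<open>The parameter \<open>t / k\<close> gives unit speed and makes
    \<open>i (k * ln a)\<close> equal to \<open>\<phi> (a, 0)\<close>.\<close>
  define i where "i t = \<phi> (exp (t / k), 0)" for t
  have pos: "fst (i t) > 0" for t using hom(1)[of "(exp (t / k), 0)"] by (simp add: i_def)
  have d: "(i has_derivative (\<lambda>s. fst (i t) *\<^sub>R s *\<^sub>R v)) (at t)" for t
  proof -
    have "((\<lambda>t. (exp (t / k), 0 :: real)) has_derivative (\<lambda>s. (exp (t / k) * (s / k), 0))) (at t)"
      using \<open>k \<noteq> 0\<close> by (auto intro!: derivative_eq_intros)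
    from has_derivative_compose[OF this deriv] show ?thesis
      by (simp add: \<xi>(1) v_def flip: i_def)
  qed
  have di: "differential i t s = fst (i t) *\<^sub>R s *\<^sub>R v" for t s
    by (simp add: differential_eqI[OF d])
  have smooth: "smooth_on (carrier real_line) i"
    using Ck_on_exponential_curve[OF d] by (simp add: smooth_on_def real_line_def)
  have "i (s + t) = i s \<otimes>\<^bsub>E1\<^esub> i t" for s t
    using hom(2)[of "(exp (s / k), 0)" "(exp (t / k), 0)"]
    by (simp add: i_def add_divide_distrib exp_add)
  then have "i \<in> lie_hom real_line E1"
    using smooth pos by (auto simp: lie_hom_def hom_def simp del: E1_simps(2))
  moreover have "riemannian_immersion (carrier real_line) flat_metric g i"
  proof -
    have "v \<noteq> 0" using \<open>k \<noteq> 0\<close> \<xi>(2) by (simp add: v_def)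
    then have "inj (differential i t)" for t
      using less_imp_neq[OF pos[of t]] by (auto intro!: injI simp: di)
    moreover have "Q v v = 1" using \<open>k \<noteq> 0\<close> by (simp add: v_def Q_simps flip: k(2))
    then have "pullback_metric g i t a b = flat_metric t a b" for t a b
      using pos[of t] by (simp add: pullback_metric_def di metric_eq Q_simps flat_metric_def power2_eq_square)
    ultimately show ?thesis using smooth by (simp add: riemannian_immersion_def)
  qed
  moreover have "\<phi> x = i (k * ln (fst x))" if x: "x \<in> carrier E1" for x
  proof -
    \<comment> \<open>\<open>\<xi>\<close> kills vertical vectors, so \<open>\<phi>\<close> depends
      on the first coordinate only.\<close>
    have "((\<lambda>b. \<phi> (fst x, b)) has_derivative (\<lambda>_. 0)) (at b within UNIV)" for b
    proof -
      have "((\<lambda>b. (fst x, b)) has_derivative (\<lambda>b. (0, b))) (at b)"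
        by (auto intro!: derivative_eq_intros)
      from has_derivative_compose[OF this deriv] show ?thesis using x by (simp add: \<xi>(1))
    qed
    then have "\<exists>c. \<forall>b\<in>UNIV. \<phi> (fst x, b) = c" by (rule has_derivative_zero_constant[OF convex_UNIV])
    then have "\<phi> (fst x, snd x) = \<phi> (fst x, 0)" by (metis UNIV_I)
    then show ?thesis using x k(1) by (simp add: i_def)
  qed
  ultimately show ?thesis using lie_hom_ln[of k]
    by (intro bexI[where x = i] bexI[where x = "\<lambda>x. k * ln (fst x)"]) blast+
qed

theorem proposition8p1:
  fixes g1 g2 :: "(real \<times> real) metric"
  assumes "left_invariant_metric E1 g1" and "left_invariant_metric E1 g2"
  shows
    "(\<forall>i \<in> lie_hom real_line E1.
        riemannian_immersion (carrier real_line) flat_metric g1 i \<longrightarrow>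
          (minimal (carrier real_line) flat_metric g1 i \<longleftrightarrow>
            (\<forall>t. \<forall>z \<in> derived_algebra E1. g1 \<one>\<^bsub>E1\<^esub> (differential i 0 t) z = 0))) \<and>
     (\<forall>\<xi> \<in> lie_hom E1 real_line.
        biharmonic (carrier E1) g1 flat_metric \<xi> \<and>
        (harmonic (carrier E1) g1 flat_metric \<xi> \<longrightarrow> \<xi> constant_on (carrier E1))) \<and>
     (\<forall>\<phi> \<in> lie_hom E1 E1.
        \<not> (\<phi> constant_on (carrier E1)) \<and> harmonic (carrier E1) g1 g2 \<phi> \<longrightarrow>
          (\<exists>c>0. \<forall>x \<in> carrier E1. \<forall>u v. pullback_metric g2 \<phi> x u v = c * g1 x u v)) \<and>
     (\<forall>\<phi> \<in> lie_hom E1 E1.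
        biharmonic (carrier E1) g1 g2 \<phi> \<and> \<not> harmonic (carrier E1) g1 g2 \<phi> \<longrightarrow>
          (\<exists>i \<in> lie_hom real_line E1. \<exists>\<xi> \<in> lie_hom E1 real_line.
             riemannian_immersion (carrier real_line) flat_metric g2 i \<and>
             biharmonic (carrier E1) g1 flat_metric \<xi> \<and>
             (\<forall>x \<in> carrier E1. \<phi> x = i (\<xi> x))))"
proof -
  interpret M: E1_metric g1 by unfold_locales (rule assms(1))
  interpret N: E1_metric g2 by unfold_locales (rule assms(2))
  obtain e f where ef: "M.orthonormal_pair e f" using M.orthonormal_pair_exists by blast
  have real_valued: "biharmonic (carrier E1) g1 flat_metric \<zeta>"
    "harmonic (carrier E1) g1 flat_metric \<zeta> \<Longrightarrow> \<zeta> constant_on (carrier E1)"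
    if "\<zeta> \<in> lie_hom E1 real_line" for \<zeta>
    using lie_hom_E1_real_line[OF that] M.biharmonic_function M.harmonic_function_constant by metis+
  have homothety: "\<exists>c>0. \<forall>x \<in> carrier E1. \<forall>u v. pullback_metric g2 \<phi> x u v = c * g1 x u v"
    if \<phi>: "\<phi> \<in> lie_hom E1 E1" "\<not> \<phi> constant_on (carrier E1)" "harmonic (carrier E1) g1 g2 \<phi>" for \<phi>
  proof -
    obtain \<xi> where \<xi>: "linear \<xi>"
      "\<And>x. fst x > 0 \<Longrightarrow> (\<phi> has_derivative (\<lambda>u. fst (\<phi> x) *\<^sub>R \<xi> ((1 / fst x) *\<^sub>R u))) (at x)"
      "\<xi> (0, 1) = 0 \<or> (\<forall>u. fst (\<xi> u) = fst u)"
      by (rule lie_hom_E1_E1[OF \<phi>(1)]) (rule that)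
    interpret E1_hom g1 g2 \<phi> \<xi>
      by (intro E1_hom.intro E1_hom_axioms.intro M.E1_metric_axioms N.E1_metric_axioms \<xi>(1,2))
        (use lie_hom_E1E(1)[OF \<phi>(1)] in simp)
    have \<tau>: "tension_vector e f = 0" using \<phi>(3) harmonic_iff[OF ef] by simp
    \<comment> \<open>In the other case harmonicity forces \<open>\<xi> = 0\<close>, so
      \<open>\<phi>\<close> would be constant.\<close>
    have "fst (\<xi> u) = fst u" for u
    proof (rule ccontr)
      assume "fst (\<xi> u) \<noteq> fst u"
      then have "\<xi> (0, 1) = 0" using \<xi>(3) by blast
      then have rank_one: "\<xi> u = fst u *\<^sub>R \<xi> (1, 0)" for u
        using linear_real_prod_eq[OF \<xi>(1), of u] by simp
      have "\<xi> (1, 0) = 0" by (rule rank_one_not_harmonic[OF ef rank_one \<tau>])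
      then have "(\<phi> has_derivative (\<lambda>_. 0)) (at x)" if "fst x > 0" for x
        using \<xi>(2)[OF that] by (subst (asm) rank_one) simp
      then show False using \<phi>(2) E1_zero_derivative_constant by blast
    qed
    note iso = this
    have "pullback_metric g2 \<phi> x u v = energy e f / 2 * g1 x u v" if "x \<in> carrier E1" for x u v
      using that pos[of x]
      by (simp add: pullback_metric_def differential_eq M.metric_eq N.metric_eq N.Q_simps \<xi>_simps
          harmonic_imp_homothety[OF iso ef \<tau>] power2_eq_square)
    then show ?thesis using energy_pos[OF iso ef] by (intro exI[of _ "energy e f / 2"]) auto
  qed
  have factor: "\<exists>i \<in> lie_hom real_line E1. \<exists>\<xi> \<in> lie_hom E1 real_line.
      riemannian_immersion (carrier real_line) flat_metric g2 i \<and> (\<forall>x \<in> carrier E1. \<phi> x = i (\<xi> x))"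
    if \<phi>: "\<phi> \<in> lie_hom E1 E1" "biharmonic (carrier E1) g1 g2 \<phi>" "\<not> harmonic (carrier E1) g1 g2 \<phi>" for \<phi>
  proof -
    obtain \<xi> where \<xi>: "linear \<xi>"
      "\<And>x. fst x > 0 \<Longrightarrow> (\<phi> has_derivative (\<lambda>u. fst (\<phi> x) *\<^sub>R \<xi> ((1 / fst x) *\<^sub>R u))) (at x)"
      "\<xi> (0, 1) = 0 \<or> (\<forall>u. fst (\<xi> u) = fst u)"
      by (rule lie_hom_E1_E1[OF \<phi>(1)]) (rule that)
    interpret E1_hom g1 g2 \<phi> \<xi>
      by (intro E1_hom.intro E1_hom_axioms.intro M.E1_metric_axioms N.E1_metric_axioms \<xi>(1,2))
        (use lie_hom_E1E(1)[OF \<phi>(1)] in simp)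
    have \<tau>: "tension_vector e f \<noteq> 0" using \<phi>(3) harmonic_iff[OF ef] by simp
    have "\<xi> (0, 1) = 0"
    proof (rule ccontr)
      assume 0: "\<xi> (0, 1) \<noteq> 0"
      then have iso: "fst (\<xi> u) = fst u" for u using \<xi>(3) by blast
      have "inj \<xi>"
      proof (rule injI)
        fix u v assume uv: "\<xi> u = \<xi> v"
        then have "fst u = fst v" using iso by metis
        then have "snd u = snd v"
          using uv 0 linear_real_prod_eq[OF \<xi>(1), of u] linear_real_prod_eq[OF \<xi>(1), of v] by simp
        with \<open>fst u = fst v\<close> show "u = v" by (simp add: prod_eq_iff)
      qed
      then show False using biharmonic_imp_harmonic[OF iso ef \<phi>(2)] \<tau> by blast
    qed
    then have rank_one: "\<xi> u = fst u *\<^sub>R \<xi> (1, 0)" for u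
      using linear_real_prod_eq[OF \<xi>(1), of u] by simp
    have "\<xi> (1, 0) \<noteq> 0"
      using \<tau> by (auto simp: rank_one_tension_vector[OF ef rank_one] N.A_def N.Q_simps)
    then show ?thesis by (rule N.factor_through_real_line[OF \<phi>(1) rank_one _ \<xi>(2)])
  qed
  show ?thesis
    \<comment> \<open>Biharmonicity of the factor into the line comes from
      \<open>real_valued\<close>.\<close>
    using M.minimal_iff real_valued homothety factor by blast
qed

end
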